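(* Let $F\subset[0,1]$ be the Cantor set, $E=F\times F\subset\mathbb R^2$, and for $\delta\in(0,1)$ let $\mathscr E_\delta$, $\Gamma_\delta$, $d_\delta$ be the Dirichlet form, energy measure and intrinsic distance on $\mathbb R^2$ described in the context. Let $D_\delta u$ be the Cheeger derivative of a Lipschitz function $u$ on $(\mathbb R^2,d_\delta,m)$ and $|||\cdot|||_{T\mathbb R^2}$ Cheeger's distinguished inner product norm. There exists $\tilde\delta_E\in(0,1)$ such that for every $\delta\in(\tilde\delta_E,1)$ one can find $u\in\mathrm{Lip}(\mathbb R^2)$ such that $$\frac{d}{dm}\Gamma_\delta(u,u)<|||D_\delta u|||^2_{T\mathbb R^2}$$ on some set of positive measure.
   Context: The Cantor set $F$: remove from $[0,1]$ the middle open interval of length $1/10$, leaving two closed intervals; for $n\ge2$, remove from each of the intervals of generation $n-1$ the middle open interval of length $(1/10)^n$; $F$ is the intersection over $n$ of the unions of the generation-$n$ closed intervals. $m$ is Lebesgue measure on $\mathbb R^2$. $\mathscr E_\delta(u,u)=\int_{\mathbb R^2}(1-\delta1_E)|\nabla u|^2\,dm$ with domain $W^{1,2}(\mathbb R^2)$; $\Gamma_\delta(u,u)=(1-\delta1_E)|\nabla u|^2\,m$; $d_\delta(x,y)=\sup\{u(x)-u(y):u\in W^{1,2}_{\mathrm{loc}}(\mathbb R^2)\cap\mathscr C(\mathbb R^2),\ \frac{d}{dm}\Gamma_\delta(u,u)\le1\text{ a.e.}\}$. The distance $d_\delta$ is bi-Lipschitz equivalent to the Euclidean one, so $\mathrm{Lip}(\mathbb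 R^2)$ is the same for both. Cheeger structure of $(\mathbb R^2,d_\delta,m)$: it can be described by a single chart $U\subset\mathbb R^2$ of full measure with coordinates $x=(x_1,x_2)$, and $D_\delta u=\frac{\partial u}{\partial x_1}\frac{\partial}{\partial x_1}+\frac{\partial u}{\partial x_2}\frac{\partial}{\partial x_2}$ a.e. for Lipschitz $u$. For a.e. $z$, $T_z\mathbb R^2$ (2-dimensional) carries the norm $\|v\|_{T_z\mathbb R^2}=\mathrm{Lip}_{d_\delta}(v_1x_1+v_2x_2)(z)$ for $v=v_1\frac{\partial}{\partial x_1}+v_2\frac{\partial}{\partial x_2}$, where $\mathrm{Lip}_{d_\delta}f(z)=\limsup_{y\to z}\frac{|f(y)-f(z)|}{d_\delta(y,z)}$. Distinguished inner product norm: for a norm $\|\cdot\|$ on a $k$-dimensional vector space $V$, define on the dual $V^*$ $|||v^*|||^*=\big(c_k\int_{B_{\|\cdot\|}(0,1)}|v^*(v)|^2\,dH^k_{\|\cdot\|}(v)\big)^{1/2}$, where $B_{\|\cdot\|}(0,1)$ is the unit ball of $\|\cdot\|$, $H^k_{\|\cdot\|}$ is the $k$-dimensional Hausdorff measure of the metric induced by $\|\cdot\|$, and $c_k>0$ is the normalizing constant depending only on $k$ such that $|||\cdot|||^*$ is the dual norm $\|\cdot\|^*$ whenever $\|\cdot\|$ is an inner product norm. Then $|||v|||=\sup_{|||v^*|||^*\le1}v^*(v)$ on $V$. $|||\cdot|||_{T\mathbb R^2}$ at $z$ is the norm obtained in this way from $\|\cdot\|_{T_z\mathbb R^2}$. 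*)

theory Defs
  imports "HOL-Analysis.Analysis"
begin

section \<open>The set \<open>E = F \<times> F\<close>\<close>

text \<open>The closed intervals of generation \<open>n\<close>, as pairs of end points.\<close>

primrec cantor_intervals :: "nat \<Rightarrow> (real \<times> real) set" where
  "cantor_intervals 0 = {(0, 1)}"
| "cantor_intervals (Suc n) =
     (\<Union>(a, b)\<in>cantor_intervals n.
        {(a, (a + b) / 2 - (1/10) ^ Suc n / 2), ((a + b) / 2 + (1/10) ^ Suc n / 2, b)})"

definition cantor_F :: "real set" where
  "cantor_F = (\<Inter>n. \<Union>(a, b)\<in>cantor_intervals n. {a..b})"

definition set_E :: "(real^2) set" where
  "set_E = {z. z $ 1 \<in> cantor_F \<and> z $ 2 \<in> cantor_F}"


section \<open>Weak gradients and the local Sobolev space\<close>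

primrec C_k :: "nat \<Rightarrow> ('a::euclidean_space \<Rightarrow> real) \<Rightarrow> bool" where
  "C_k 0 f = continuous_on UNIV f"
| "C_k (Suc k) f = ((\<forall>x. f differentiable (at x)) \<and>
     (\<forall>b\<in>Basis. C_k k (\<lambda>x. frechet_derivative f (at x) b)))"

definition test_function :: "('a::euclidean_space \<Rightarrow> real) \<Rightarrow> bool" where
  "test_function \<phi> \<longleftrightarrow> (\<forall>k. C_k k \<phi>) \<and> (\<exists>K. compact K \<and> (\<forall>x. x \<notin> K \<longrightarrow> \<phi> x = 0))"

definition loc_integrable :: "(real^2 \<Rightarrow> 'b::euclidean_space) \<Rightarrow> bool" where
  "loc_integrable u \<longleftrightarrow> (\<forall>K. compact K \<longrightarrow> set_integrable lebesgue K u)"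

definition L2_loc :: "(real^2 \<Rightarrow> 'b::euclidean_space) \<Rightarrow> bool" where
  "L2_loc u \<longleftrightarrow> u \<in> borel_measurable lebesgue \<and>
     (\<forall>K. compact K \<longrightarrow> set_integrable lebesgue K (\<lambda>z. (norm (u z))\<^sup>2))"

definition has_weak_gradient :: "(real^2 \<Rightarrow> real) \<Rightarrow> (real^2 \<Rightarrow> real^2) \<Rightarrow> bool" where
  "has_weak_gradient u g \<longleftrightarrow> loc_integrable u \<and> loc_integrable g \<and>
     (\<forall>\<phi>. test_function \<phi> \<longrightarrow> (\<forall>i.
        (LINT z|lebesgue. u z * frechet_derivative \<phi> (at z) (axis i 1)) =
        - (LINT z|lebesgue. g z $ i * \<phi> z)))"

text \<open>A weak gradient is determined only up to a null set; this picks a representative.\<close>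

definition weak_gradient :: "(real^2 \<Rightarrow> real) \<Rightarrow> real^2 \<Rightarrow> real^2" where
  "weak_gradient u = (SOME g. has_weak_gradient u g)"

definition W12_loc :: "(real^2 \<Rightarrow> real) \<Rightarrow> bool" where
  "W12_loc u \<longleftrightarrow> L2_loc u \<and> (\<exists>g. has_weak_gradient u g \<and> L2_loc g)"


section \<open>Energy measure and intrinsic distance\<close>

definition energy_measure :: "real \<Rightarrow> (real^2 \<Rightarrow> real) \<Rightarrow> (real^2) measure" where
  "energy_measure \<delta> u =
     density lebesgue (\<lambda>z. ennreal ((1 - \<delta> * indicator set_E z) * (norm (weak_gradient u z))\<^sup>2))"

definition energy_density :: "real \<Rightarrow> (real^2 \<Rightarrow> real) \<Rightarrow> real^2 \<Rightarrow> ennreal" where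
  "energy_density \<delta> u = RN_deriv lebesgue (energy_measure \<delta> u)"

text \<open>For \<open>0 < \<delta> < 1\<close> the set below is bounded above (the distance is bi-Lipschitz equivalent
  to the Euclidean one), so the supremum of reals is the intended one.\<close>

definition intrinsic_dist :: "real \<Rightarrow> real^2 \<Rightarrow> real^2 \<Rightarrow> real" where
  "intrinsic_dist \<delta> x y = Sup {u x - u y | u.
     W12_loc u \<and> continuous_on UNIV u \<and> (AE z in lebesgue. energy_density \<delta> u z \<le> 1)}"


section \<open>Hausdorff measure\<close>

definition ediam :: "('a \<Rightarrow> 'a \<Rightarrow> real) \<Rightarrow> 'a set \<Rightarrow> ennreal" where
  "ediam d A = (SUP (x, y)\<in>A \<times> A. ennreal (d x y))"

definition hausdorff_pre :: "nat \<Rightarrow> ('a \<Rightarrow> 'a \<Rightarrow> real) \<Rightarrow> real \<Rightarrow> 'a set \<Rightarrow> ennreal" where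
  "hausdorff_pre k d \<epsilon> A =
     (INF C \<in> {C :: nat \<Rightarrow> 'a set. A \<subseteq> (\<Union>i. C i) \<and> (\<forall>i. ediam d (C i) \<le> ennreal \<epsilon>)}.
        \<Sum>i. if C i = {} then 0
            else ennreal (unit_ball_vol (real k) / 2 ^ k) * ediam d (C i) ^ k)"

definition hausdorff_outer :: "nat \<Rightarrow> ('a \<Rightarrow> 'a \<Rightarrow> real) \<Rightarrow> 'a set \<Rightarrow> ennreal" where
  "hausdorff_outer k d A = (SUP \<epsilon>\<in>{0<..}. hausdorff_pre k d \<epsilon> A)"

text \<open>Intended for metrics \<open>d\<close> that induce the topology of the type, so that the Borel sets are
  those of \<open>d\<close>.\<close>

definition hausdorff_measure ::
    "nat \<Rightarrow> ('a::topological_space \<Rightarrow> 'a \<Rightarrow> real) \<Rightarrow> 'a measure" where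
  "hausdorff_measure k d = measure_of UNIV (sets borel) (hausdorff_outer k d)"


section \<open>The distinguished inner product norm of a finite-dimensional normed space\<close>

text \<open>The vector space is the type \<open>'a\<close>, of dimension \<open>DIM('a)\<close>; its norm is the function
  \<open>N\<close>, unrelated to the built-in norm. Dual vectors are linear functionals.\<close>

definition inner_product_norm :: "('a::euclidean_space \<Rightarrow> real) \<Rightarrow> bool" where
  "inner_product_norm N \<longleftrightarrow> (\<exists>B. bilinear B \<and> (\<forall>v w. B v w = B w v) \<and>
     (\<forall>v. v \<noteq> 0 \<longrightarrow> 0 < B v v) \<and> (\<forall>v. N v = sqrt (B v v)))"

definition dual_norm :: "('a::euclidean_space \<Rightarrow> real) \<Rightarrow> ('a \<Rightarrow> real) \<Rightarrow> real" where
  "dual_norm N f = (SUP v\<in>{v. N v \<le> 1}. \<bar>f v\<bar>)"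

definition ball_L2_norm ::
    "real \<Rightarrow> ('a::euclidean_space \<Rightarrow> real) \<Rightarrow> ('a \<Rightarrow> real) \<Rightarrow> real" where
  "ball_L2_norm c N f =
     sqrt (c * (LINT v:{v. N v < 1}|hausdorff_measure DIM('a) (\<lambda>x y. N (x - y)). \<bar>f v\<bar>\<^sup>2))"

text \<open>The normalizing constant \<open>c\<^sub>k\<close>, \<open>k = DIM('a)\<close>.\<close>

definition cheeger_const :: "'a::euclidean_space itself \<Rightarrow> real" where
  "cheeger_const (_ :: 'a itself) = (THE c. 0 < c \<and>
     (\<forall>N :: 'a \<Rightarrow> real. inner_product_norm N \<longrightarrow>
        (\<forall>f. linear f \<longrightarrow> ball_L2_norm c N f = dual_norm N f)))"

definition distinguished_dual_norm ::
    "('a::euclidean_space \<Rightarrow> real) \<Rightarrow> ('a \<Rightarrow> real) \<Rightarrow> real" where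
  "distinguished_dual_norm N = ball_L2_norm (cheeger_const TYPE('a)) N"

definition distinguished_norm :: "('a::euclidean_space \<Rightarrow> real) \<Rightarrow> 'a \<Rightarrow> real" where
  "distinguished_norm N v = (SUP f\<in>{f. linear f \<and> distinguished_dual_norm N f \<le> 1}. f v)"


section \<open>Cheeger structure of the plane with the intrinsic distance\<close>

text \<open>The limit \<open>y \<rightarrow> z\<close> is taken in the Euclidean topology, which is also that of
  the distances \<open>d\<close> considered here.\<close>

definition pointwise_Lip ::
    "(real^2 \<Rightarrow> real^2 \<Rightarrow> real) \<Rightarrow> (real^2 \<Rightarrow> real) \<Rightarrow> real^2 \<Rightarrow> ereal" where
  "pointwise_Lip d f z = Limsup (at z) (\<lambda>y. ereal (\<bar>f y - f z\<bar> / d y z))"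

text \<open>The tangent space at \<open>z\<close> is identified with \<open>real^2\<close> through the basis
  \<open>\<partial>/\<partial>x\<^sub>1, \<partial>/\<partial>x\<^sub>2\<close> given by the coordinate chart. The pointwise Lipschitz constant below
  is finite since \<open>intrinsic_dist \<delta>\<close> is bi-Lipschitz equivalent to the Euclidean distance.\<close>

definition tangent_norm :: "real \<Rightarrow> real^2 \<Rightarrow> real^2 \<Rightarrow> real" where
  "tangent_norm \<delta> z v =
     real_of_ereal (pointwise_Lip (intrinsic_dist \<delta>) (\<lambda>x. v $ 1 * x $ 1 + v $ 2 * x $ 2) z)"

text \<open>For Lipschitz \<open>u\<close> the partial derivatives exist almost everywhere (Rademacher). In the chart
  above the Cheeger derivative does not depend on \<open>\<delta>\<close>.\<close>

definition cheeger_derivative :: "(real^2 \<Rightarrow> real) \<Rightarrow> real^2 \<Rightarrow> real^2" where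
  "cheeger_derivative u z = (\<chi> i. deriv (\<lambda>t. u (z + t *\<^sub>R axis i 1)) 0)"

end

theory Submission
  imports Defs
begin

text \<open>The function \<open>u = x\<^sub>1\<close> works. On \<open>E\<close>, which has positive measure, its energy density
  is \<open>1 - \<delta>\<close>, which tends to \<open>0\<close> as \<open>\<delta> \<rightarrow> 1\<close>. The distinguished norm of its Cheeger derivative,
  however, is bounded below independently of \<open>\<delta>\<close>: the axis-parallel lines that avoid \<open>E\<close> are dense
  and the weight is \<open>1\<close> near them, so that \<open>d\<^sub>\<delta>\<close> is at most the \<open>\<ell>\<^sup>1\<close> distance; it is at least
  the Euclidean one because \<open>1 - \<delta> 1\<^sub>E \<le> 1\<close>. Hence every tangent norm lies between the maximum
  norm and the Euclidean norm, and crude volume bounds control the inner product built from it.\<close>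

section \<open>The Cantor set\<close>

text \<open>The obstacle is that the distinguished norm is built from the Hausdorff measure of a
  norm that varies with the base point and is not known explicitly; it is therefore estimated, never
  evaluated. The bounds change direction on the way: a distance at most the l1 distance makes
  pointwise Lipschitz constants of linear functions at least the norm dual to l1, the maximum norm,
  and a distance at least Euclidean makes them at most Euclidean. The unit ball then sits in a
  square of Hausdorff measure at most 4 pi, so the functional l x_1 with l^2 =
  \<open>disc_integral\<close> / (4 pi) is in the dual unit ball for all these norms, and its value
  l is the uniform lower bound. The number \<open>disc_integral\<close> enters through the
  normalising constant, its reciprocal, which is fixed by inner product norms alone and hence free
  of \<delta>. The upper bound on the distance cannot be read off along one segment, as a weak
  gradient is determined only almost everywhere: segments are thickened, and continuity carries the
  bound from the dense set of lines to all of them.\<close>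

lemma cantor_intervals_length:
  "(a, b) \<in> cantor_intervals n \<Longrightarrow> b - a = (7 / 8 + (1 / 5) ^ n / 8) / 2 ^ n"
proof (induction n arbitrary: a b)
  case (Suc n)
  then obtain c d where cd: "(c, d) \<in> cantor_intervals n" and
    ab: "(a = c \<and> b = (c + d) / 2 - (1/10) ^ Suc n / 2) \<or> (a = (c + d) / 2 + (1/10) ^ Suc n / 2 \<and> b = d)"
    by auto
  from ab have "b - a = (d - c) / 2 - (1/10) ^ Suc n / 2"
    by (auto simp: field_simps)
  \<comment> \<open>Multiplied by 2^n, the recursion for the lengths telescopes to 1 - (5^-1 + ... +
    5^-n) / 2 = 7/8 + 5^-n / 8.\<close>
  also have "\<dots> = (7 / 8 + (1 / 5) ^ Suc n / 8) / 2 ^ Suc n"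
  proof -
    have "(1/10::real) ^ n = (1/5) ^ n / 2 ^ n"
      by (simp add: power_divide flip: power_mult_distrib)
    then show ?thesis
      unfolding Suc.IH[OF cd] by (simp add: field_simps)
  qed
  finally show ?case .
qed auto

text \<open>Ensures that cutting out the gap of generation n + 1 leaves two nondegenerate children
  inside the parent. Disjointness and the midpoint argument both rest on this nesting.\<close>

lemma cantor_intervals_length_gt:
  assumes "(a, b) \<in> cantor_intervals n" shows "(1 / 10) ^ Suc n < b - a"
proof -
  have "(1/10::real) ^ n = (1/5) ^ n / 2 ^ n"
    by (simp add: power_divide flip: power_mult_distrib)
  moreover have "(1/5::real) ^ n \<le> 1"
    by (simp add: power_le_one)
  ultimately show ?thesis
    unfolding cantor_intervals_length[OF assms] by (simp add: field_simps add_pos_pos)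
qed

lemma cantor_intervals_length_le:
  assumes "(a, b) \<in> cantor_intervals n" shows "b - a \<le> (1 / 2) ^ n"
proof -
  have "(1/5::real) ^ n \<le> 1"
    by (simp add: power_le_one)
  then show ?thesis
    unfolding cantor_intervals_length[OF assms] by (simp add: field_simps)
qed

lemma finite_cantor_intervals: "finite (cantor_intervals n)"
  by (induction n) auto

lemma card_cantor_intervals: "card (cantor_intervals n) \<le> 2 ^ n"
proof (induction n)
  case (Suc n)
  have "card (cantor_intervals (Suc n)) \<le> (\<Sum>I\<in>cantor_intervals n. 2)"
    unfolding cantor_intervals.simps
    by (intro order_trans[OF card_UN_le[OF finite_cantor_intervals]] sum_mono)
       (auto simp: card_insert_if)
  also have "\<dots> \<le> 2 ^ Suc n"
    using Suc by simp
  finally show ?case .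
qed auto

text \<open>Siblings are kept apart by the removed gap; children of different parents lie in those
  parents, which are disjoint by induction.\<close>

lemma cantor_intervals_disjoint:
  "(a, b) \<in> cantor_intervals n \<Longrightarrow> (c, d) \<in> cantor_intervals n \<Longrightarrow> (a, b) \<noteq> (c, d)
     \<Longrightarrow> {a..b} \<inter> {c..d} = {}"
proof (induction n arbitrary: a b c d)
  case (Suc n)
  define e :: real where "e = (1/10) ^ Suc n"
  have "0 < e" by (simp add: e_def)
  obtain a' b' where 1: "(a', b') \<in> cantor_intervals n"
    and ab: "(a = a' \<and> b = (a' + b') / 2 - e / 2) \<or> (a = (a' + b') / 2 + e / 2 \<and> b = b')"
    using Suc.prems(1) by (auto simp: e_def)
  obtain c' d' where 2: "(c', d') \<in> cantor_intervals n"
    and cd: "(c = c' \<and> d = (c' + d') / 2 - e / 2) \<or> (c = (c' + d') / 2 + e / 2 \<and> d = d')"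
    using Suc.prems(2) by (auto simp: e_def)
  have l: "e < b' - a'" "e < d' - c'"
    using cantor_intervals_length_gt[OF 1] cantor_intervals_length_gt[OF 2] by (simp_all add: e_def)
  have "{a..b} \<subseteq> {a'..b'}" "{c..d} \<subseteq> {c'..d'}"
    using ab cd l \<open>0 < e\<close> by (auto simp: field_simps)
  moreover have "{a'..b'} \<inter> {c'..d'} = {}" if "(a', b') \<noteq> (c', d')"
    using Suc.IH[OF 1 2 that] .
  moreover have "{a..b} \<inter> {c..d} = {}" if "(a', b') = (c', d')"
    using that ab cd \<open>0 < e\<close> Suc.prems(3) by auto
  ultimately show ?case by blast
qed auto

lemma closed_cantor_F: "closed cantor_F"
  unfolding cantor_F_def
  by (intro closed_INT ballI closed_UN finite_cantor_intervals) auto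

text \<open>The midpoint of a generation \<open>n\<close> interval is removed in generation \<open>n + 1\<close>.\<close>

lemma complement_cantor_F_dense:
  assumes "0 < e" shows "\<exists>y. y \<notin> cantor_F \<and> \<bar>y - x\<bar> < e"
proof (cases "x \<in> cantor_F")
  case True
  obtain n where n: "(1 / 2 :: real) ^ n < e"
    using real_arch_pow_inv[OF assms, of "1/2"] by auto
  from True have "x \<in> (\<Union>(a, b)\<in>cantor_intervals n. {a..b})"
    unfolding cantor_F_def by blast
  then obtain a b where ab: "(a, b) \<in> cantor_intervals n" "a \<le> x" "x \<le> b"
    by auto
  define m where "m = (a + b) / 2"
  have "m \<notin> (\<Union>(a, b)\<in>cantor_intervals (Suc n). {a..b})"
  proof
    define t :: real where "t = (1/10) ^ Suc n"
    have "0 < t" by (simp add: t_def)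
    assume "m \<in> (\<Union>(a, b)\<in>cantor_intervals (Suc n). {a..b})"
    then obtain c d where cd: "(c, d) \<in> cantor_intervals n"
      and m: "(c \<le> m \<and> m \<le> (c + d) / 2 - t / 2) \<or> ((c + d) / 2 + t / 2 \<le> m \<and> m \<le> d)"
      by (auto simp: t_def)
    have "t < b - a" "t < d - c"
      using cantor_intervals_length_gt[OF ab(1)] cantor_intervals_length_gt[OF cd]
      by (simp_all add: t_def)
    then have "m \<in> {a..b}" "m \<in> {c..d}"
      using m \<open>0 < t\<close> by (auto simp: m_def field_simps)
    then have "(a, b) = (c, d)"
      using cantor_intervals_disjoint[OF ab(1) cd] by blast
    then have "m = (c + d) / 2"
      by (simp add: m_def)
    then show False
      using m \<open>0 < t\<close> by linarith
  qed
  then have "m \<notin> cantor_F"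
    unfolding cantor_F_def by blast
  moreover have "\<bar>m - x\<bar> \<le> (b - a) / 2"
    using ab by (auto simp: m_def abs_le_iff field_simps)
  then have "\<bar>m - x\<bar> < e"
    using cantor_intervals_length_le[OF ab(1)] n ab by auto
  ultimately show ?thesis by blast
qed (use assms in auto)

text \<open>It suffices to count what is removed: at most 2^n gaps of length 10^-(n+1) from
  generation n, hence at most 5^-n / 10, and these bounds sum to 1/8, less than the length of the
  unit interval.\<close>

lemma emeasure_cantor_F_pos: "0 < emeasure lborel cantor_F"
proof -
  define U where "U n = (\<Union>(a, b)\<in>cantor_intervals n. {a..b})" for n
  define D where "D n = (\<Union>(a, b)\<in>cantor_intervals n.
    {(a + b) / 2 - (1/10) ^ Suc n / 2 <..< (a + b) / 2 + (1/10) ^ Suc n / 2})" for n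
  have U_D: "U n \<subseteq> U (Suc n) \<union> D n" for n
  proof
    fix x assume "x \<in> U n"
    then obtain a b where ab: "(a, b) \<in> cantor_intervals n" "x \<in> {a..b}"
      by (auto simp: U_def)
    define t :: real where "t = (1/10) ^ Suc n"
    have "x \<le> (a + b) / 2 - t / 2 \<or> (a + b) / 2 + t / 2 \<le> x
        \<or> x \<in> {(a + b) / 2 - t / 2 <..< (a + b) / 2 + t / 2}"
      by auto
    moreover have "x \<in> U (Suc n)" if "x \<le> (a + b) / 2 - t / 2 \<or> (a + b) / 2 + t / 2 \<le> x"
    proof -
      have "(a, (a + b) / 2 - t / 2) \<in> cantor_intervals (Suc n)"
        "((a + b) / 2 + t / 2, b) \<in> cantor_intervals (Suc n)"
        using ab(1) unfolding t_def cantor_intervals.simps by (rule_tac UN_I[of "(a, b)"]; simp)+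
      moreover have "x \<in> {a..(a + b) / 2 - t / 2} \<or> x \<in> {(a + b) / 2 + t / 2..b}"
        using ab(2) that by auto
      ultimately show ?thesis
        unfolding U_def by (metis UN_I case_prod_conv)
    qed
    moreover have "x \<in> D n" if "x \<in> {(a + b) / 2 - t / 2 <..< (a + b) / 2 + t / 2}"
      using ab that unfolding D_def t_def by (intro UN_I[of "(a, b)"]) auto
    ultimately show "x \<in> U (Suc n) \<union> D n" by blast
  qed
  have U: "{0..1} \<subseteq> U n \<union> (\<Union>n. D n)" for n
  proof (induction n)
    case 0
    then show ?case by (auto simp: U_def)
  next
    case (Suc n)
    then show ?case using U_D[of n] by blast
  qed
  have sub: "{0..1} \<subseteq> cantor_F \<union> (\<Union>n. D n)"
  proof
    fix x :: real assume "x \<in> {0..1}"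
    then have "x \<in> U n \<union> (\<Union>n. D n)" for n
      using U by blast
    then show "x \<in> cantor_F \<union> (\<Union>n. D n)"
      unfolding cantor_F_def U_def by auto
  qed
  have D_sets[measurable]: "D n \<in> sets lborel" for n
    unfolding D_def by (intro sets.finite_UN finite_cantor_intervals) auto
  have [measurable]: "cantor_F \<in> sets borel"
    by (rule borel_closed[OF closed_cantor_F])
  have D_le: "emeasure lborel (D n) \<le> ennreal ((1 / 5) ^ n / 10)" for n
  proof -
    have "emeasure lborel (D n) \<le> (\<Sum>I\<in>cantor_intervals n. emeasure lborel (case I of (a, b) \<Rightarrow>
        {(a + b) / 2 - (1/10) ^ Suc n / 2 <..< (a + b) / 2 + (1/10) ^ Suc n / 2}))"
      unfolding D_def by (intro emeasure_subadditive_finite finite_cantor_intervals) auto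
    also have "\<dots> = (\<Sum>I\<in>cantor_intervals n. ennreal ((1/10) ^ Suc n))"
      by (intro sum.cong refl) (auto simp: field_simps)
    also have "\<dots> = of_nat (card (cantor_intervals n)) * ennreal ((1/10) ^ Suc n)"
      by simp
    also have "\<dots> \<le> of_nat (2 ^ n) * ennreal ((1/10) ^ Suc n)"
      using card_cantor_intervals by (intro mult_right_mono of_nat_mono) auto
    also have "\<dots> = ennreal (2 ^ n * (1/10) ^ Suc n)"
      by (simp add: ennreal_of_nat_eq_real_of_nat flip: ennreal_mult)
    also have "2 ^ n * (1/10) ^ Suc n = (1 / 5 :: real) ^ n / 10"
      by (simp flip: power_mult_distrib)
    finally show ?thesis .
  qed
  have "(\<lambda>n. (1 / 5) ^ n / 10 :: real) sums (1 / 8)"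
    using sums_divide[OF geometric_sums[of "1/5::real"], of 10] by simp
  then have S: "(\<Sum>n. ennreal ((1 / 5) ^ n / 10)) = ennreal (1 / 8)"
    by (intro suminf_ennreal_eq) auto
  have "1 = emeasure lborel {0..1::real}" by simp
  also have "\<dots> \<le> emeasure lborel (cantor_F \<union> (\<Union>n. D n))"
    using sub by (intro emeasure_mono) measurable
  also have "\<dots> \<le> emeasure lborel cantor_F + emeasure lborel (\<Union>n. D n)"
    by (intro emeasure_subadditive) measurable
  also have "emeasure lborel (\<Union>n. D n) \<le> (\<Sum>n. emeasure lborel (D n))"
    using D_sets by (intro emeasure_subadditive_countably) blast
  also have "\<dots> \<le> ennreal (1 / 8)"
    unfolding S[symmetric] by (intro suminf_le D_le) auto
  finally have *: "1 \<le> emeasure lborel cantor_F + ennreal (1 / 8)"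
    by (simp add: add_left_mono)
  show ?thesis
  proof (rule ccontr)
    assume "\<not> 0 < emeasure lborel cantor_F"
    then have "emeasure lborel cantor_F = 0" by (simp add: zero_less_iff_neq_zero)
    with * show False by (simp flip: ennreal_1)
  qed
qed

lemma closed_set_E: "closed set_E"
proof -
  have *: "set_E = (\<lambda>z. z $ 1) -` cantor_F \<inter> (\<lambda>z. z $ 2) -` cantor_F"
    by (auto simp: set_E_def)
  show ?thesis
    unfolding * by (intro closed_Int closed_vimage closed_cantor_F continuous_intros)
qed

section \<open>Product sets in the plane\<close>

text \<open>Tonelli, with the coordinates named by arbitrary distinct indices so that one statement
  serves horizontal and vertical segments alike.\<close>

lemma nn_integral_vec2_prod:
  fixes f g :: "real \<Rightarrow> ennreal" and i j :: 2
  assumes [measurable]: "f \<in> borel_measurable borel" "g \<in> borel_measurable borel" and "i \<noteq> j"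
  shows "(\<integral>\<^sup>+z. f (z $ i) * g (z $ j) \<partial>(lborel :: (real^2) measure)) =
    (\<integral>\<^sup>+x. f x \<partial>lborel) * (\<integral>\<^sup>+x. g x \<partial>lborel)"
proof -
  have U: "UNIV = {i, j}"
    using assms(3) exhaust_2[of i] exhaust_2[of j] by (auto simp: UNIV_2)
  have B: "(Basis :: (real^2) set) = {axis i 1, axis j 1}"
    by (auto simp: Basis_vec_def U)
  have ne: "(axis i 1 :: real^2) \<noteq> axis j 1"
    using assms(3) by (simp add: axis_eq_axis)
  define F where "F b = (if b = (axis i 1 :: real^2) then f else g)" for b
  have "(\<integral>\<^sup>+z. f (z $ i) * g (z $ j) \<partial>(lborel :: (real^2) measure)) =
      (\<integral>\<^sup>+z. (\<Prod>b\<in>Basis. F b (z \<bullet> b)) \<partial>lborel)"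
    using ne by (intro nn_integral_cong) (auto simp: B F_def inner_axis)
  also have "\<dots> = (\<Prod>b\<in>Basis. \<integral>\<^sup>+x. F b x \<partial>lborel)"
    by (intro nn_integral_lborel_prod) (auto simp: F_def)
  also have "\<dots> = (\<integral>\<^sup>+x. f x \<partial>lborel) * (\<integral>\<^sup>+x. g x \<partial>lborel)"
    using ne by (simp add: B F_def)
  finally show ?thesis .
qed

lemma emeasure_vec2_times:
  fixes A B :: "real set"
  assumes [measurable]: "A \<in> sets borel" "B \<in> sets borel"
  shows "emeasure lborel {z :: real^2. z $ 1 \<in> A \<and> z $ 2 \<in> B} = emeasure lborel A * emeasure lborel B"
proof -
  have "emeasure lborel {z :: real^2. z $ 1 \<in> A \<and> z $ 2 \<in> B} =
      (\<integral>\<^sup>+z. indicator {z :: real^2. z $ 1 \<in> A \<and> z $ 2 \<in> B} z \<partial>lborel)"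
    by (subst nn_integral_indicator) auto
  also have "\<dots> = (\<integral>\<^sup>+z. indicator A (z $ 1) * indicator B (z $ 2) \<partial>(lborel :: (real^2) measure))"
    by (intro nn_integral_cong) (auto simp: indicator_def)
  also have "\<dots> = emeasure lborel A * emeasure lborel B"
    by (subst nn_integral_vec2_prod) auto
  finally show ?thesis .
qed

lemma emeasure_set_E_pos: "0 < emeasure lborel set_E"
  using emeasure_vec2_times[of cantor_F cantor_F] emeasure_cantor_F_pos closed_cantor_F
  by (simp add: set_E_def borel_closed ennreal_zero_less_mult_iff)

section \<open>Smooth functions\<close>

lemma frechet_derivative_eq:
  "(f has_derivative f') (at x) \<Longrightarrow> frechet_derivative f (at x) = f'"
  by (rule frechet_derivative_at[symmetric])

lemma C_k_const: "C_k k (\<lambda>_. c)"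
proof (induction k arbitrary: c)
  case (Suc k)
  then show ?case
    by (simp add: frechet_derivative_eq[OF has_derivative_const])
qed auto

lemma C_k_SucD: "C_k (Suc k) f \<Longrightarrow> C_k k f"
proof (induction k arbitrary: f)
  case 0
  then show ?case
    by (simp add: continuous_on_eq_continuous_within differentiable_imp_continuous_within)
next
  case (Suc k)
  then show ?case by (metis C_k.simps(2))
qed

lemma C_k_add: "C_k k f \<Longrightarrow> C_k k g \<Longrightarrow> C_k k (\<lambda>x. f x + g x)"
proof (induction k arbitrary: f g)
  case (Suc k)
  have "frechet_derivative (\<lambda>x. f x + g x) (at x) =
      (\<lambda>b. frechet_derivative f (at x) b + frechet_derivative g (at x) b)" for x
    using Suc.prems
    by (intro frechet_derivative_eq has_derivative_add) (auto simp: frechet_derivative_works)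
  then show ?case
    using Suc by auto
qed (auto intro: continuous_intros)

lemma C_k_mult: "C_k k f \<Longrightarrow> C_k k g \<Longrightarrow> C_k k (\<lambda>x. f x * g x)"
proof (induction k arbitrary: f g)
  case (Suc k)
  have "frechet_derivative (\<lambda>x. f x * g x) (at x) =
      (\<lambda>b. f x * frechet_derivative g (at x) b + frechet_derivative f (at x) b * g x)" for x
    using Suc.prems
    by (intro frechet_derivative_eq has_derivative_mult) (auto simp: frechet_derivative_works)
  then show ?case
    using Suc C_k_SucD[OF Suc.prems(1)] C_k_SucD[OF Suc.prems(2)]
    by (auto intro!: C_k_add Suc.IH)
qed (auto intro: continuous_intros)

text \<open>Covers two uses: with b an axis vector, z \<bullet> b reads off a coordinate of the
  plane; on the real line s \<bullet> c is multiplication, so the statement gives rescaling and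
  translation.\<close>

lemma C_k_compose_affine:
  fixes f :: "real \<Rightarrow> real" and b :: "'a::euclidean_space"
  shows "C_k k f \<Longrightarrow> C_k k (\<lambda>z. f (a + z \<bullet> b))"
proof (induction k arbitrary: f)
  case 0
  then show ?case
    by (auto intro!: continuous_on_compose2[of UNIV f] continuous_intros)
next
  case (Suc k)
  have D: "((\<lambda>z. f (a + z \<bullet> b)) has_derivative
      (\<lambda>v. frechet_derivative f (at (a + x \<bullet> b)) 1 * (v \<bullet> b))) (at x)" for x
  proof -
    have f: "(f has_derivative (\<lambda>t. t * frechet_derivative f (at (a + x \<bullet> b)) 1)) (at (a + x \<bullet> b))"
    proof -
      obtain d where d: "(f has_derivative (*) d) (at (a + x \<bullet> b))"
        using Suc.prems by (auto simp: real_differentiable_def has_field_derivative_def)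
      moreover have "(\<lambda>t. t * d) = (*) d"
        by (simp add: fun_eq_iff mult.commute)
      ultimately show ?thesis
        by (simp add: frechet_derivative_eq[OF d])
    qed
    have "((\<lambda>z. a + z \<bullet> b) has_derivative (\<lambda>v. v \<bullet> b)) (at x)"
      by (auto intro!: derivative_eq_intros)
    from has_derivative_compose[OF this f] show ?thesis
      by (simp add: mult.commute)
  qed
  have "C_k k (\<lambda>x. frechet_derivative f (at (a + x \<bullet> b)) 1 * (v \<bullet> b))" for v
    using Suc.prems Suc.IH[of "\<lambda>x. frechet_derivative f (at x) 1"]
    by (intro C_k_mult C_k_const) auto
  with D show ?case
    by (auto simp: frechet_derivative_eq[OF D] differentiable_def)
qed

text \<open>Spares the computation of iterated Frechet derivatives: it is enough to exhibit a list
  \<open>D\<close> of successive derivatives.\<close>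

lemma C_k_derivative_sequence:
  fixes D :: "nat \<Rightarrow> real \<Rightarrow> real"
  assumes "\<And>n x. (D n has_real_derivative D (Suc n) x) (at x)"
  shows "C_k k (D n)"
proof (induction k arbitrary: n)
  case 0
  show ?case
    using assms by (auto intro!: DERIV_continuous_on)
next
  case (Suc k)
  have "frechet_derivative (D n) (at x) = (*) (D (Suc n) x)" for x
    using assms by (intro frechet_derivative_eq) (simp add: has_field_derivative_def)
  then show ?case
    using Suc assms by (auto simp: real_differentiable_def) blast
qed

section \<open>Flat functions and a smooth step\<close>

text \<open>The classical flat function exp(-1/x), extended by 0, is the case p = 1. The polynomial
  factor in 1/x makes the family closed under differentiation.\<close>

definition flat_exp :: "real poly \<Rightarrow> real \<Rightarrow> real" where
  "flat_exp p x = (if 0 < x then poly p (1 / x) * exp (- (1 / x)) else 0)"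

lemma flat_exp_1:
  "0 \<le> flat_exp 1 x" "0 < x \<Longrightarrow> 0 < flat_exp 1 x" "x \<le> 0 \<Longrightarrow> flat_exp 1 x = 0"
  by (simp_all add: flat_exp_def)

lemma tendsto_poly_exp_0: "((\<lambda>y. poly p y * exp (- y)) \<longlongrightarrow> (0::real)) at_top"
proof -
  have "((\<lambda>y. \<Sum>i\<le>degree p. coeff p i * (y ^ i / exp y)) \<longlongrightarrow> (\<Sum>i\<le>degree p. coeff p i * 0)) at_top"
    by (intro tendsto_intros tendsto_power_div_exp_0)
  then show ?thesis
    by (simp add: poly_altdef sum_distrib_right exp_minus divide_inverse mult.assoc)
qed

text \<open>With y = 1/x, the derivative of p(y) exp(-y) in x is y^2 (p - p')(y) exp(-y); the factor
  \<open>[:0, 0, 1:]\<close> is y^2. At 0 exponential decay beats every polynomial.\<close>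

lemma flat_exp_deriv:
  "(flat_exp p has_real_derivative flat_exp ([:0, 0, 1:] * (p - pderiv p)) x) (at x)"
proof (cases x "0 :: real" rule: linorder_cases)
  case less
  have "((\<lambda>_. 0) has_real_derivative 0) (at x)" by simp
  then have "(flat_exp p has_real_derivative 0) (at x)"
    by (rule has_field_derivative_transform_within_open[where S = "{..<0}"])
       (use less in \<open>auto simp: flat_exp_def\<close>)
  with less show ?thesis by (simp add: flat_exp_def)
next
  case greater
  have "((\<lambda>x. poly p (1 / x) * exp (- (1 / x))) has_real_derivative
      flat_exp ([:0, 0, 1:] * (p - pderiv p)) x) (at x)"
    using greater
    by (auto intro!: derivative_eq_intros simp: flat_exp_def field_simps power2_eq_square)
  then show ?thesis
    by (rule has_field_derivative_transform_within_open[where S = "{0<..}"])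
       (use greater in \<open>auto simp: flat_exp_def\<close>)
next
  case equal
  \<comment> \<open>\<open>pCons 0 p\<close> multiplies by the argument 1/h, so this is the right
    difference quotient of \<open>flat_exp p\<close> at 0.\<close>
  have "((\<lambda>h. poly (pCons 0 p) (inverse h) * exp (- inverse h)) \<longlongrightarrow> 0) (at_right (0::real))"
    by (rule filterlim_compose[OF tendsto_poly_exp_0 filterlim_inverse_at_top_right])
  then have "((\<lambda>h. (flat_exp p (0 + h) - flat_exp p 0) / h) \<longlongrightarrow> 0) (at_right (0::real))"
    by (rule Lim_transform_eventually)
       (auto simp: flat_exp_def eventually_at_filter field_simps intro!: always_eventually)
  moreover have "((\<lambda>h. (flat_exp p (0 + h) - flat_exp p 0) / h) \<longlongrightarrow> 0) (at_left (0::real))"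
    by (rule Lim_transform_eventually[OF tendsto_const])
       (auto simp: flat_exp_def eventually_at_filter intro!: always_eventually)
  ultimately show ?thesis
    using equal by (auto simp: DERIV_def filterlim_at_split flat_exp_def)
qed

lemma C_k_flat_exp: "C_k k (flat_exp p)"
proof -
  define P where "P n = ((\<lambda>p. [:0, 0, 1:] * (p - pderiv p)) ^^ n) p" for n
  have "C_k k (flat_exp (P 0))"
  proof (rule C_k_derivative_sequence)
    show "(flat_exp (P n) has_real_derivative flat_exp (P (Suc n)) x) (at x)" for n x
      using flat_exp_deriv[of "P n"] by (simp add: P_def)
  qed
  then show ?thesis by (simp add: P_def)
qed

text \<open>R is the normalised primitive of the bump exp(-1/x) exp(-1/(1-x)) on (0,1). Its
  derivative \<rho> is recorded as well, because differentiating a cutoff made from R must yield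
  mollifiers made from \<rho>.\<close>

lemma smooth_step_exists:
  obtains R \<rho> :: "real \<Rightarrow> real" where
    "\<And>x. (R has_real_derivative \<rho> x) (at x)" "\<And>k. C_k k R" "\<And>k. C_k k \<rho>"
    "\<And>x. 0 \<le> \<rho> x" "\<And>x. x \<notin> {0..1} \<Longrightarrow> \<rho> x = 0"
    "\<And>x. x \<le> 0 \<Longrightarrow> R x = 0" "\<And>x. 1 \<le> x \<Longrightarrow> R x = 1" "\<And>x. 0 \<le> R x" "\<And>x. R x \<le> 1"
proof -
  define \<sigma> where "\<sigma> x = flat_exp 1 x * flat_exp 1 (1 - x)" for x
  have nonneg: "0 \<le> \<sigma> x" for x
    by (simp add: \<sigma>_def flat_exp_1)
  have pos: "0 < \<sigma> x" if "0 < x" "x < 1" for x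
    using that by (simp add: \<sigma>_def flat_exp_1)
  have zero: "\<sigma> x = 0" if "x \<le> 0 \<or> 1 \<le> x" for x
    using that by (auto simp: \<sigma>_def flat_exp_1)
  have C_\<sigma>: "C_k k \<sigma>" for k
    using C_k_mult[OF C_k_flat_exp[of k 1] C_k_compose_affine[OF C_k_flat_exp[of k 1], of 1 "-1::real"]]
    by (simp add: \<sigma>_def[abs_def])
  have "continuous_on UNIV \<sigma>"
    using C_\<sigma>[of 0] by simp
  then have "isCont \<sigma> x" for x
    by (simp add: continuous_on_eq_continuous_at)
  \<comment> \<open>A primitive on the whole line, taken from the version for open intervals with
    possibly infinite end points.\<close>
  then have "\<exists>F. \<forall>x :: real. -\<infinity> < ereal x \<longrightarrow> ereal x < \<infinity> \<longrightarrow> (F has_vector_derivative \<sigma> x) (at x)"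
    by (intro einterval_antiderivative) simp_all
  then obtain F where "\<And>x. (F has_vector_derivative \<sigma> x) (at x)"
    by auto
  then have F: "(F has_real_derivative \<sigma> x) (at x)" for x
    by (simp add: has_real_derivative_iff_has_vector_derivative)
  have cont_F: "continuous_on A F" for A
    using F by (meson DERIV_isCont continuous_at_imp_continuous_on)
  have mono: "F x \<le> F y" if "x \<le> y" for x y
    by (rule DERIV_nonneg_imp_nondecreasing[OF that, of F]) (use F nonneg in blast)
  have F0: "F x = F 0" if "x \<le> 0" for x
  proof (cases "x = 0")
    case False
    have "F 0 = F x"
    proof (rule DERIV_isconst_end[of x 0 F])
      show "x < 0" using False that by simp
      show "(F has_real_derivative 0) (at t)" if "x < t" "t < 0" for t
        using F[of t] zero[of t] that by simp
    qed (rule cont_F)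
    then show ?thesis by simp
  qed auto
  have F1: "F x = F 1" if "1 \<le> x" for x
  proof (cases "x = 1")
    case False
    show ?thesis
    proof (rule DERIV_isconst_end[of 1 x F])
      show "1 < x" using False that by simp
      show "(F has_real_derivative 0) (at t)" if "1 < t" "t < x" for t
        using F[of t] zero[of t] that by simp
    qed (rule cont_F)
  qed auto
  have F01: "F 0 < F 1"
  proof (rule DERIV_pos_imp_increasing_open[of 0 1 F])
    show "\<exists>y. (F has_real_derivative y) (at x) \<and> 0 < y" if "0 < x" "x < 1" for x
      using F[of x] pos[OF that] by blast
  qed (simp_all add: cont_F)
  define c where "c = F 1 - F 0"
  have "0 < c" using F01 by (simp add: c_def)
  define R where "R x = (F x - F 0) * (1 / c)" for x
  define \<rho> where "\<rho> x = \<sigma> x * (1 / c)" for x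
  have R: "(R has_real_derivative \<rho> x) (at x)" for x
    unfolding R_def \<rho>_def by (rule derivative_eq_intros F refl)+ simp
  have C_\<rho>: "C_k k \<rho>" for k
    unfolding \<rho>_def by (intro C_k_mult C_k_const C_\<sigma>)
  show ?thesis
  proof (rule that[of R \<rho>])
    show "C_k k R" for k
    proof (cases k)
      case 0
      then show ?thesis
        using R by (auto intro!: DERIV_continuous_on)
    next
      case (Suc j)
      have "frechet_derivative R (at x) = (*) (\<rho> x)" for x
        using R by (intro frechet_derivative_eq) (simp add: has_field_derivative_def)
      then show ?thesis
        using Suc C_\<rho> R by (auto simp: real_differentiable_def)
    qed
    show "0 \<le> R x" for x
    proof (cases "0 \<le> x")
      case True
      with mono[OF True] \<open>0 < c\<close> show ?thesis by (simp add: R_def)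
    next
      case False
      with F0[of x] show ?thesis by (simp add: R_def)
    qed
    show "R x \<le> 1" for x
    proof (cases "x \<le> 1")
      case True
      with mono[OF True] \<open>0 < c\<close> show ?thesis by (simp add: R_def c_def)
    next
      case False
      with F1[of x] \<open>0 < c\<close> show ?thesis by (simp add: R_def c_def)
    qed
    show "R x = 0" if "x \<le> 0" for x
      using F0[OF that] by (simp add: R_def)
    show "R x = 1" if "1 \<le> x" for x
      using F1[OF that] \<open>0 < c\<close> by (simp add: R_def c_def)
    show "0 \<le> \<rho> x" for x
      using nonneg[of x] \<open>0 < c\<close> by (simp add: \<rho>_def)
    show "\<rho> x = 0" if "x \<notin> {0..1}" for x
      using zero[of x] that by (auto simp: \<rho>_def)
  qed (rule R C_\<rho>)+
qed

section \<open>Weak gradients\<close>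

text \<open>Local integrability speaks only of restrictions to compact sets; the function itself is
  the pointwise limit of its truncations to balls of integer radius.\<close>

lemma loc_integrable_measurable:
  fixes f :: "real^2 \<Rightarrow> 'b::euclidean_space"
  assumes "loc_integrable f" shows "f \<in> borel_measurable lebesgue"
proof (rule borel_measurable_LIMSEQ_metric)
  fix n :: nat
  show "(\<lambda>z. indicator (cball 0 (real n)) z *\<^sub>R f z) \<in> borel_measurable lebesgue"
    using assms by (auto simp: loc_integrable_def set_integrable_def intro!: borel_measurable_integrable)
next
  fix z :: "real^2"
  obtain N where N: "norm z \<le> real N"
    using real_arch_simple by blast
  have "\<forall>\<^sub>F n in sequentially. indicator (cball 0 (real n)) z *\<^sub>R f z = f z"
    using eventually_ge_at_top[of N] by eventually_elim (use N in auto)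
  then show "(\<lambda>n. indicator (cball 0 (real n)) z *\<^sub>R f z) \<longlonglongrightarrow> f z"
    by (rule tendsto_eventually)
qed

lemma loc_integrable_component:
  fixes g :: "real^2 \<Rightarrow> real^2"
  assumes "loc_integrable g" shows "loc_integrable (\<lambda>z. g z $ i)"
  unfolding loc_integrable_def set_integrable_def
proof (intro allI impI)
  fix K :: "(real^2) set" assume "compact K"
  then have "integrable lebesgue (\<lambda>z. indicator K z *\<^sub>R g z)"
    using assms by (auto simp: loc_integrable_def set_integrable_def)
  from integrable_bounded_linear[OF bounded_linear_vec_nth[of i] this]
  show "integrable lebesgue (\<lambda>z. indicator K z *\<^sub>R g z $ i)"
    by simp
qed

lemma continuous_lebesgue_measurable:
  "continuous_on UNIV f \<Longrightarrow> f \<in> borel_measurable lebesgue"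
  by (intro measurable_completion) (auto intro: borel_measurable_continuous_onI)

lemma loc_integrable_continuous:
  fixes f :: "real^2 \<Rightarrow> 'b::euclidean_space"
  assumes "continuous_on UNIV f" shows "loc_integrable f"
  unfolding loc_integrable_def set_integrable_def
proof (intro allI impI)
  fix K :: "(real^2) set" assume "compact K"
  then have "integrable lborel (\<lambda>z. indicator K z *\<^sub>R f z)"
    using assms by (intro borel_integrable_compact) (auto intro: continuous_on_subset)
  then show "integrable lebesgue (\<lambda>z. indicator K z *\<^sub>R f z)"
    by (simp add: integrable_completion)
qed

text \<open>A non-integrable function has integral 0 by convention, so the pairings with test
  functions may be split and compared only after this integrability is known.\<close>

lemma integrable_loc_integrable_times:
  fixes f \<phi> :: "real^2 \<Rightarrow> real"
  assumes f: "loc_integrable f" and \<phi>: "continuous_on UNIV \<phi>"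
    and K: "compact K" "\<And>z. z \<notin> K \<Longrightarrow> \<phi> z = 0"
  shows "integrable lebesgue (\<lambda>z. f z * \<phi> z)"
proof -
  have "bounded (\<phi> ` K)"
    using \<phi> K by (intro compact_imp_bounded compact_continuous_image) (auto intro: continuous_on_subset)
  then obtain M where M: "\<And>z. z \<in> K \<Longrightarrow> \<bar>\<phi> z\<bar> \<le> M"
    by (auto simp: bounded_iff)
  have "integrable lebesgue (\<lambda>z. M * (indicator K z *\<^sub>R f z))"
    using f K by (auto simp: loc_integrable_def set_integrable_def)
  then show ?thesis
  proof (rule Bochner_Integration.integrable_bound)
    show "(\<lambda>z. f z * \<phi> z) \<in> borel_measurable lebesgue"
      using loc_integrable_measurable[OF f] continuous_lebesgue_measurable[OF \<phi>] by measurable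
    have "norm (f z * \<phi> z) \<le> norm (M * (indicator K z *\<^sub>R f z))" for z
    proof (cases "z \<in> K")
      case True
      have "\<bar>\<phi> z\<bar> * \<bar>f z\<bar> \<le> \<bar>M\<bar> * \<bar>f z\<bar>"
        using M[OF True] by (intro mult_right_mono) auto
      with True show ?thesis by (simp add: abs_mult mult.commute)
    qed (use K in auto)
    then show "AE z in lebesgue. norm (f z * \<phi> z) \<le> norm (M * (indicator K z *\<^sub>R f z))"
      by simp
  qed
qed

lemma test_function_continuous: "test_function \<phi> \<Longrightarrow> continuous_on UNIV \<phi>"
  by (metis C_k.simps(1) test_function_def)

lemma test_function_product:
  fixes A B :: "real \<Rightarrow> real" and i j :: 2
  assumes C: "\<And>k. C_k k A" "\<And>k. C_k k B" and "i \<noteq> j"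
    and A: "\<And>s. s \<notin> {a..b} \<Longrightarrow> A s = 0" and B: "\<And>s. s \<notin> {c..d} \<Longrightarrow> B s = 0"
  shows "test_function (\<lambda>z::real^2. A (z $ i) * B (z $ j))"
  unfolding test_function_def
proof (intro conjI allI)
  fix k show "C_k k (\<lambda>z::real^2. A (z $ i) * B (z $ j))"
    using C_k_mult[OF C_k_compose_affine[OF C(1), of k 0 "axis i 1 :: real^2"]
        C_k_compose_affine[OF C(2), of k 0 "axis j 1 :: real^2"]]
    by (simp add: inner_axis)
next
  define K :: "(real^2) set" where "K = cbox (\<chi> k. if k = i then a else c) (\<chi> k. if k = i then b else d)"
  have "A (z $ i) * B (z $ j) = 0" if "z \<notin> K" for z :: "real^2"
  proof -
    have "k = i \<or> k = j" for k
      using assms(3) exhaust_2[of i] exhaust_2[of j] exhaust_2[of k] by auto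
    with that have "z $ i \<notin> {a..b} \<or> z $ j \<notin> {c..d}"
      unfolding K_def mem_box_cart by fastforce
    then show ?thesis
      using A[of "z $ i"] B[of "z $ j"] by auto
  qed
  then show "\<exists>K. compact K \<and> (\<forall>z. z \<notin> K \<longrightarrow> A (z $ i) * B (z $ j) = 0)"
    by (intro exI[of _ K]) (auto simp: K_def compact_cbox)
qed

lemma partial_derivative_product:
  fixes A B :: "real \<Rightarrow> real" and i j :: 2 and z :: "real^2"
  assumes "(A has_real_derivative a) (at (z $ i))" "\<And>s. B differentiable (at s)" "i \<noteq> j"
  shows "frechet_derivative (\<lambda>z::real^2. A (z $ i) * B (z $ j)) (at z) (axis i 1) = a * B (z $ j)"
proof -
  obtain b where b: "(B has_real_derivative b) (at (z $ j))"
    using assms(2)[of "z $ j"] by (auto simp: real_differentiable_def)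
  have n: "((\<lambda>z. z $ k) has_derivative (\<lambda>v. v $ k)) (at z)" for k
    by (rule bounded_linear_imp_has_derivative[OF bounded_linear_vec_nth])
  have "((\<lambda>z. A (z $ i) * B (z $ j)) has_derivative
      (\<lambda>v. A (z $ i) * (b * v $ j) + a * v $ i * B (z $ j))) (at z)"
    using has_derivative_compose[OF n[of i], of A "(*) a"] has_derivative_compose[OF n[of j], of B "(*) b"]
      assms(1) b
    by (intro has_derivative_mult) (simp_all add: has_field_derivative_def)
  from frechet_derivative_eq[OF this] show ?thesis
    using assms(3) by (simp add: axis_def)
qed

text \<open>The box indicators are pointwise limits of products of smooth steps; Lebesgue differentiation
  then recovers \<open>f\<close> from its vanishing averages.\<close>

lemma fundamental_lemma_calculus_of_variations:
  fixes f :: "real^2 \<Rightarrow> real"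
  assumes f: "loc_integrable f"
    and zero: "\<And>\<phi>. test_function \<phi> \<Longrightarrow> (LINT z|lebesgue. f z * \<phi> z) = 0"
  shows "AE z in lebesgue. f z = 0"
proof -
  obtain R :: "real \<Rightarrow> real" where
    R: "\<And>k. C_k k R" "\<And>x. x \<le> 0 \<Longrightarrow> R x = 0" "\<And>x. 1 \<le> x \<Longrightarrow> R x = 1"
      "\<And>x. 0 \<le> R x" "\<And>x. R x \<le> 1"
    by (rule smooth_step_exists, rule that; assumption)
  \<comment> \<open>Equal to 1 on [a,b], with ramps of width 1/n on the outside. For n = 0 it is
    constantly 1, without compact support, which is why \<open>Suc n\<close> is used from here
    on.\<close>
  define A where "A a b n s = R (1 + real n * (s - a)) - R (real n * (s - b))" for a b n s
  have C_A: "C_k k (A a b n)" for k a b n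
  proof -
    have "C_k k (\<lambda>s. R (1 - real n * a + s \<bullet> real n) + (-1) * R (- real n * b + s \<bullet> real n))"
      by (intro C_k_add C_k_mult C_k_const C_k_compose_affine R)
    then show ?thesis
      by (simp add: A_def[abs_def] algebra_simps)
  qed
  have A0: "A a b (Suc n) s = 0" if "s \<notin> {a - 1..b + 1}" "a \<le> b" for a b n s
  proof (cases "s < a - 1")
    case True
    have "real (Suc n) * (s - a) \<le> real (Suc n) * (-1)" "real (Suc n) * (s - b) \<le> 0"
      using True that by (intro mult_left_mono mult_nonneg_nonpos; simp)+
    then show ?thesis
      unfolding A_def by (subst (1 2) R(2)) auto
  next
    case False
    with that have "0 \<le> s - a" "1 \<le> s - b"
      by auto
    then have "0 \<le> real (Suc n) * (s - a)" "1 \<le> real (Suc n) * (s - b)"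
      using mult_mono[of 1 "real (Suc n)" 1 "s - b"] by auto
    then show ?thesis
      unfolding A_def by (subst (1 2) R(3)) auto
  qed
  have A1: "\<bar>A a b n s\<bar> \<le> 1" for a b n s
    using R(4,5)[of "1 + real n * (s - a)"] R(4,5)[of "real n * (s - b)"] by (auto simp: A_def)
  have lim: "(\<lambda>n. A a b (Suc n) s) \<longlonglongrightarrow> indicator {a..b} s" if "a \<le> b" for a b s
  proof -
    have large: "\<forall>\<^sub>F n in sequentially. 1 \<le> real (Suc n) * t" if "0 < t" for t
    proof -
      obtain N where "1 \<le> real N * t"
        using reals_Archimedean3[OF \<open>0 < t\<close>] less_imp_le by meson
      then have "1 \<le> real (Suc n) * t" if "N \<le> n" for n
        using that \<open>0 < t\<close> by (smt (verit) mult_right_mono of_nat_mono le_Suc_eq)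
      then show ?thesis
        by (auto simp: eventually_sequentially)
    qed
    have "(\<lambda>n. R (1 + real (Suc n) * (s - a))) \<longlonglongrightarrow> indicator {a..} s"
    proof (cases "a \<le> s")
      case True
      then show ?thesis by (subst R(3)) auto
    next
      case False
      have "\<forall>\<^sub>F n in sequentially. R (1 + real (Suc n) * (s - a)) = 0"
        using large[of "a - s"] False by (auto elim!: eventually_mono intro!: R(2) simp: algebra_simps)
      with False show ?thesis by (simp add: tendsto_eventually)
    qed
    moreover have "(\<lambda>n. R (real (Suc n) * (s - b))) \<longlonglongrightarrow> indicator {b<..} s"
    proof (cases "s \<le> b")
      case True
      then show ?thesis by (subst R(2)) (auto intro: mult_nonneg_nonpos)
    next
      case False
      have "\<forall>\<^sub>F n in sequentially. R (real (Suc n) * (s - b)) = 1"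
        using large[of "s - b"] False by (auto elim!: eventually_mono intro!: R(3))
      with False show ?thesis by (simp add: tendsto_eventually)
    qed
    ultimately have "(\<lambda>n. A a b (Suc n) s) \<longlonglongrightarrow> indicator {a..} s - indicator {b<..} s"
      unfolding A_def by (rule tendsto_diff)
    moreover have "indicator {a..} s - indicator {b<..} s = (indicator {a..b} s :: real)"
      using that by (auto simp: indicator_def)
    ultimately show ?thesis by simp
  qed
  have box_int: "f absolutely_integrable_on cbox a b" for a b
    using f by (auto simp: loc_integrable_def compact_cbox)
  have box0: "integral (cbox a b) f = 0" if ab: "\<And>i. a $ i \<le> b $ i" for a b
  proof -
    define \<phi> where "\<phi> n z = A (a $ 1) (b $ 1) (Suc n) (z $ 1) * A (a $ 2) (b $ 2) (Suc n) (z $ 2)"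
      for n and z :: "real^2"
    define K where "K = cbox (a - (\<chi> i. 1)) (b + (\<chi> i. 1))"
    have test: "test_function (\<phi> n)" for n
      unfolding \<phi>_def
      by (rule test_function_product[OF C_A C_A _ A0[OF _ ab] A0[OF _ ab]]) auto
    have meas: "f \<in> borel_measurable lebesgue" "\<phi> n \<in> borel_measurable lebesgue" for n
      by (rule loc_integrable_measurable[OF f])
         (rule continuous_lebesgue_measurable[OF test_function_continuous[OF test]])
    have lim_\<phi>: "(\<lambda>n. \<phi> n z) \<longlonglongrightarrow> indicator (cbox a b) z" for z
    proof -
      have "(\<lambda>n. \<phi> n z) \<longlonglongrightarrow> indicator {a $ 1..b $ 1} (z $ 1) * indicator {a $ 2..b $ 2} (z $ 2)"
        unfolding \<phi>_def by (intro tendsto_mult lim ab)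
      also have "indicator {a $ 1..b $ 1} (z $ 1) * indicator {a $ 2..b $ 2} (z $ 2) =
          (indicator (cbox a b) z :: real)"
        by (auto simp: indicator_def mem_box_cart forall_2)
      finally show ?thesis .
    qed
    have bound: "norm (f z * \<phi> n z) \<le> norm (indicator K z *\<^sub>R f z)" for n z
    proof (cases "z \<in> K")
      case True
      have "\<bar>\<phi> n z\<bar> \<le> 1 * 1"
        unfolding \<phi>_def abs_mult by (intro mult_mono A1) auto
      then have "\<bar>f z\<bar> * \<bar>\<phi> n z\<bar> \<le> \<bar>f z\<bar> * 1"
        by (intro mult_left_mono) auto
      with True show ?thesis by (simp add: abs_mult)
    next
      case False
      then have "z $ 1 \<notin> {a $ 1 - 1..b $ 1 + 1} \<or> z $ 2 \<notin> {a $ 2 - 1..b $ 2 + 1}"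
        by (auto simp: K_def mem_box_cart forall_2)
      then have "\<phi> n z = 0"
        unfolding \<phi>_def using A0 ab by (metis mult_eq_0_iff)
      then show ?thesis by simp
    qed
    have "(\<lambda>n. LINT z|lebesgue. f z * \<phi> n z) \<longlonglongrightarrow> (LINT z|lebesgue. f z * indicator (cbox a b) z)"
    proof (rule integral_dominated_convergence)
      show "integrable lebesgue (\<lambda>z. norm (indicator K z *\<^sub>R f z))"
        using f by (intro integrable_norm) (auto simp: loc_integrable_def set_integrable_def K_def compact_cbox)
      show "(\<lambda>z. f z * indicator (cbox a b) z) \<in> borel_measurable lebesgue"
        by (intro borel_measurable_times borel_measurable_indicator meas) simp
      show "(\<lambda>z. f z * \<phi> n z) \<in> borel_measurable lebesgue" for n
        by (intro borel_measurable_times meas)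
      show "AE z in lebesgue. (\<lambda>n. f z * \<phi> n z) \<longlonglongrightarrow> f z * indicator (cbox a b) z"
        by (intro AE_I2 tendsto_mult tendsto_const lim_\<phi>)
      show "AE z in lebesgue. norm (f z * \<phi> n z) \<le> norm (indicator K z *\<^sub>R f z)" for n
        using bound by simp
    qed
    moreover have "(LINT z|lebesgue. f z * \<phi> n z) = 0" for n
      by (rule zero[OF test])
    ultimately have "(LINT z|lebesgue. f z * indicator (cbox a b) z) = 0"
      by (simp add: LIMSEQ_const_iff)
    then have "set_lebesgue_integral lebesgue (cbox a b) f = 0"
      by (simp add: set_lebesgue_integral_def mult.commute)
    then show ?thesis
      using set_lebesgue_integral_eq_integral(2)[OF box_int] by simp
  qed
  obtain N where N: "negligible N"
    and avg: "\<And>x e. x \<notin> N \<Longrightarrow> 0 < e \<Longrightarrow> \<exists>d>0. \<forall>h. 0 < h \<and> h < d \<longrightarrow>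
      norm (integral (cbox x (x + h *\<^sub>R One)) f /\<^sub>R h ^ DIM(real^2) - f x) < e"
    using integrable_ccontinuous_explicit[of f] box_int
    by (metis set_lebesgue_integral_eq_integral(1))
  have "f x = 0" if x: "x \<notin> N" for x
  proof (rule ccontr)
    assume "f x \<noteq> 0"
    then obtain d where d: "0 < d" "\<And>h. 0 < h \<Longrightarrow> h < d \<Longrightarrow>
        norm (integral (cbox x (x + h *\<^sub>R One)) f /\<^sub>R h ^ DIM(real^2) - f x) < \<bar>f x\<bar>"
      using avg[OF x, of "\<bar>f x\<bar>"] by auto
    \<comment> \<open>With a vanishing average, the differentiation bound for the tolerance |f x|
      would read |f x| < |f x|.\<close>
    have "integral (cbox x (x + (d / 2) *\<^sub>R One)) f = 0"
      using d by (intro box0) (auto simp: cart_eq_inner_axis inner_add_left simp del: vector_add_component)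
    with d(2)[of "d / 2"] d(1) show False by simp
  qed
  then have "{x \<in> space lebesgue. f x \<noteq> 0} \<subseteq> N" by auto
  then show ?thesis
    using N by (intro AE_I'[of N]) (auto simp: negligible_iff_null_sets)
qed

text \<open>Both candidates have the same pairings with every test function, so each component of
  their difference falls under the fundamental lemma. This lets an explicit gradient stand in for
  the arbitrary choice made by \<open>weak_gradient\<close>.\<close>

lemma weak_gradient_unique:
  assumes g: "has_weak_gradient u g" and h: "has_weak_gradient u h"
  shows "AE z in lebesgue. g z = h z"
proof -
  have int: "integrable lebesgue (\<lambda>z. g z $ i * \<phi> z)" "integrable lebesgue (\<lambda>z. h z $ i * \<phi> z)"
    if \<phi>: "test_function \<phi>" for i \<phi>
  proof -
    obtain K where "compact K" "\<And>z. z \<notin> K \<Longrightarrow> \<phi> z = 0"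
      using \<phi> by (auto simp: test_function_def)
    then show "integrable lebesgue (\<lambda>z. g z $ i * \<phi> z)" "integrable lebesgue (\<lambda>z. h z $ i * \<phi> z)"
      using g h test_function_continuous[OF \<phi>]
      by (auto intro!: integrable_loc_integrable_times loc_integrable_component simp: has_weak_gradient_def)
  qed
  have "AE z in lebesgue. g z $ i - h z $ i = 0" for i
  proof (rule fundamental_lemma_calculus_of_variations)
    have "loc_integrable (\<lambda>z. g z $ i)" "loc_integrable (\<lambda>z. h z $ i)"
      using g h by (auto simp: has_weak_gradient_def intro: loc_integrable_component)
    then show "loc_integrable (\<lambda>z. g z $ i - h z $ i)"
      unfolding loc_integrable_def by (auto intro: set_integral_diff)
    show "(LINT z|lebesgue. (g z $ i - h z $ i) * \<phi> z) = 0" if "test_function \<phi>" for \<phi>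
    proof -
      have "(LINT z|lebesgue. u z * frechet_derivative \<phi> (at z) (axis i 1)) = - (LINT z|lebesgue. g z $ i * \<phi> z)"
        using g that unfolding has_weak_gradient_def by blast
      moreover have "(LINT z|lebesgue. u z * frechet_derivative \<phi> (at z) (axis i 1)) = - (LINT z|lebesgue. h z $ i * \<phi> z)"
        using h that unfolding has_weak_gradient_def by blast
      ultimately show ?thesis
        using int[OF that, of i] by (simp add: left_diff_distrib)
    qed
  qed
  from this[of 1] this[of 2] show ?thesis
    by eventually_elim (simp add: vec_eq_iff forall_2)
qed

text \<open>For the uniqueness of the Radon-Nikodym derivative with respect to the completed
  measure; balls of integer radius exhaust the space.\<close>

lemma sigma_finite_lebesgue: "sigma_finite_measure (lebesgue :: 'a::euclidean_space measure)"
proof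
  define A where "A = range (\<lambda>n::nat. cball (0::'a) (real n))"
  have "x \<in> \<Union>A" for x
    using real_arch_simple[of "norm x"] by (auto simp: A_def)
  moreover have "emeasure lebesgue a \<noteq> \<infinity>" if "a \<in> A" for a
    using that emeasure_lborel_cball_finite[of "0::'a"] by (auto simp: A_def less_top)
  ultimately show "\<exists>A. countable A \<and> A \<subseteq> sets lebesgue \<and> \<Union>A = space (lebesgue :: 'a measure)
      \<and> (\<forall>a\<in>A. emeasure lebesgue a \<noteq> \<infinity>)"
    by (intro exI[of _ A]) (auto simp: A_def)
qed

text \<open>The density depends on two choices, of a weak gradient and of a Radon-Nikodym
  derivative. Each is determined almost everywhere, so any weak gradient at hand may be used to
  compute it.\<close>

lemma energy_density_eq:
  assumes "has_weak_gradient u g"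
  shows "AE z in lebesgue. energy_density \<delta> u z = ennreal ((1 - \<delta> * indicator set_E z) * (norm (g z))\<^sup>2)"
proof -
  have w: "has_weak_gradient u (weak_gradient u)"
    unfolding weak_gradient_def by (rule someI[of "has_weak_gradient u", OF assms])
  then have [measurable]: "weak_gradient u \<in> borel_measurable lebesgue"
    by (auto simp: has_weak_gradient_def intro: loc_integrable_measurable)
  have [measurable]: "set_E \<in> sets lebesgue"
    using closed_set_E by (auto intro: borel_closed)
  interpret sigma_finite_measure "lebesgue :: (real^2) measure"
    by (rule sigma_finite_lebesgue)
  have "AE z in lebesgue. ennreal ((1 - \<delta> * indicator set_E z) * (norm (weak_gradient u z))\<^sup>2) =
      RN_deriv lebesgue (energy_measure \<delta> u) z"
    by (rule RN_deriv_unique) (auto simp: energy_measure_def)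
  with weak_gradient_unique[OF assms w] show ?thesis
    unfolding energy_density_def by eventually_elim simp
qed

text \<open>Translation invariance makes the integrals of the difference quotients vanish.\<close>

lemma integral_directional_derivative_eq_0:
  fixes \<psi> :: "'a::euclidean_space \<Rightarrow> real"
  assumes D: "\<And>x. (\<psi> has_derivative D x) (at x)" and cont: "continuous_on UNIV (\<lambda>x. D x b)"
    and K: "compact K" "\<And>x. x \<notin> K \<Longrightarrow> \<psi> x = 0"
  shows "(LINT x|lborel. D x b) = 0"
proof -
  have cont_\<psi>: "continuous_on UNIV \<psi>"
    using D by (meson continuous_at_imp_continuous_on has_derivative_continuous)
  have [measurable]: "\<psi> \<in> borel_measurable borel" "(\<lambda>x. D x b) \<in> borel_measurable borel"
    using cont cont_\<psi> by (auto intro: borel_measurable_continuous_onI)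
  define F where "F n x = real (Suc n) * (\<psi> (x + b /\<^sub>R real (Suc n)) - \<psi> x)" for n x
  have [measurable]: "F n \<in> borel_measurable borel" for n
    unfolding F_def by measurable
  have int_\<psi>: "integrable lborel \<psi>"
  proof -
    have "integrable lborel (\<lambda>x. indicator K x *\<^sub>R \<psi> x)"
      using K cont_\<psi> by (intro borel_integrable_compact) (auto intro: continuous_on_subset)
    also have "(\<lambda>x. indicator K x *\<^sub>R \<psi> x) = \<psi>"
      using K by (auto simp: indicator_def fun_eq_iff)
    finally show ?thesis .
  qed
  have shift: "integrable lborel (\<lambda>x. \<psi> (x + c))" "(LINT x|lborel. \<psi> (x + c)) = (LINT x|lborel. \<psi> x)" for c
  proof -
    have l: "distr lborel borel ((+) c) = (lborel :: 'a measure)"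
      by (rule lborel_distr_plus)
    have "(LINT x|lborel. \<psi> x) = (LINT x|distr lborel borel ((+) c). \<psi> x)"
      by (simp add: l)
    also have "\<dots> = (LINT x|lborel. \<psi> (c + x))"
      by (subst integral_distr) auto
    finally show "(LINT x|lborel. \<psi> (x + c)) = (LINT x|lborel. \<psi> x)"
      by (simp add: add.commute)
    have "integrable (distr lborel borel ((+) c)) \<psi>"
      by (simp add: l int_\<psi>)
    then have "integrable lborel (\<lambda>x. \<psi> (c + x))"
      by (subst (asm) integrable_distr_eq) auto
    then show "integrable lborel (\<lambda>x. \<psi> (x + c))"
      by (simp add: add.commute)
  qed
  have F0: "(LINT x|lborel. F n x) = 0" for n
    unfolding F_def using shift int_\<psi> by (simp del: of_nat_Suc)
  obtain r where r: "\<And>x. x \<in> K \<Longrightarrow> norm x \<le> r"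
    using compact_imp_bounded[OF K(1)] unfolding bounded_iff by blast
  \<comment> \<open>Difference quotients with steps of length at most \<open>norm b\<close> vanish
    outside radius r + \<open>norm b\<close>; a second \<open>norm b\<close> makes room for the mean
    value points x + t b with t < 1.\<close>
  define C where "C = cball (0::'a) (r + 2 * norm b)"
  have "bounded ((\<lambda>x. D x b) ` C)"
    using cont by (intro compact_imp_bounded compact_continuous_image)
      (auto simp: C_def intro: continuous_on_subset)
  then obtain M where M: "\<And>x. x \<in> C \<Longrightarrow> \<bar>D x b\<bar> \<le> M"
    by (auto simp: bounded_iff)
  have quot: "(\<lambda>n. F n x) \<longlonglongrightarrow> D x b" for x
  proof -
    have "((\<lambda>t. x + t *\<^sub>R b) has_derivative (\<lambda>t. t *\<^sub>R b)) (at 0)"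
      by (auto intro!: derivative_eq_intros)
    from has_derivative_compose[OF this, of \<psi> "D x"] D[of x]
    have "((\<lambda>t. \<psi> (x + t *\<^sub>R b)) has_derivative (\<lambda>t. D x (t *\<^sub>R b))) (at 0)"
      by simp
    moreover have "(\<lambda>t. D x (t *\<^sub>R b)) = (\<lambda>t. D x b * t)"
      using has_derivative_linear[OF D[of x]] by (auto simp: linear_cmul fun_eq_iff)
    ultimately have "((\<lambda>t. \<psi> (x + t *\<^sub>R b)) has_real_derivative D x b) (at 0)"
      by (simp add: has_field_derivative_def)
    then have "((\<lambda>h. (\<psi> (x + h *\<^sub>R b) - \<psi> x) / h) \<longlongrightarrow> D x b) (at 0)"
      by (simp add: DERIV_def)
    moreover have "filterlim (\<lambda>n. inverse (real (Suc n))) (at 0) sequentially"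
      using LIMSEQ_inverse_real_of_nat by (simp add: filterlim_at del: of_nat_Suc)
    ultimately have "(\<lambda>n. (\<psi> (x + inverse (real (Suc n)) *\<^sub>R b) - \<psi> x) / inverse (real (Suc n))) \<longlonglongrightarrow> D x b"
      by (rule filterlim_compose)
    then show ?thesis
      by (simp add: F_def divide_inverse mult.commute del: of_nat_Suc)
  qed
  have bound: "\<bar>F n x\<bar> \<le> M * indicator (cball 0 (r + norm b)) x" for n x
  proof (cases "x \<in> cball 0 (r + norm b)")
    case True
    define f where "f t = \<psi> (x + t *\<^sub>R b)" for t
    have df: "(f has_real_derivative D (x + t *\<^sub>R b) b) (at t)" for t
    proof -
      have "((\<lambda>t. x + t *\<^sub>R b) has_derivative (\<lambda>t. t *\<^sub>R b)) (at t)"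
        by (auto intro!: derivative_eq_intros)
      from has_derivative_compose[OF this, of \<psi> "D (x + t *\<^sub>R b)"] D
      have "(f has_derivative (\<lambda>s. D (x + t *\<^sub>R b) (s *\<^sub>R b))) (at t)"
        by (simp add: f_def[abs_def])
      moreover have "(\<lambda>s. D (x + t *\<^sub>R b) (s *\<^sub>R b)) = (\<lambda>s. D (x + t *\<^sub>R b) b * s)"
        using has_derivative_linear[OF D[of "x + t *\<^sub>R b"]] by (auto simp: linear_cmul fun_eq_iff)
      ultimately show ?thesis
        by (simp add: has_field_derivative_def)
    qed
    define h where "h = inverse (real (Suc n))"
    have h: "0 < h" "h \<le> 1"
      by (auto simp: h_def field_simps)
    obtain t where t: "0 < t" "t < h" "f h - f 0 = (h - 0) * D (x + t *\<^sub>R b) b"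
      using MVT2[OF h(1), of f "\<lambda>t. D (x + t *\<^sub>R b) b"] df by auto
    have "norm (x + t *\<^sub>R b) \<le> norm x + t * norm b"
      using t norm_triangle_ineq[of x "t *\<^sub>R b"] by simp
    also have "t * norm b \<le> 1 * norm b"
      using t h by (intro mult_right_mono) auto
    finally have "x + t *\<^sub>R b \<in> C"
      using True by (simp add: C_def)
    moreover have "F n x = D (x + t *\<^sub>R b) b"
      using t(3) h by (simp add: F_def f_def h_def field_simps del: of_nat_Suc)
    ultimately show ?thesis
      using M True by simp
  next
    case False
    have "x \<notin> K"
    proof
      assume "x \<in> K"
      from r[OF this] have "norm x \<le> r + norm b"
        by (rule order_trans) simp
      with False show False by simp
    qed
    moreover have "x + b /\<^sub>R real (Suc n) \<notin> K"
    proof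
      assume "x + b /\<^sub>R real (Suc n) \<in> K"
      then have "norm (x + b /\<^sub>R real (Suc n)) \<le> r"
        by (rule r)
      moreover have "norm x \<le> norm (x + b /\<^sub>R real (Suc n)) + norm (b /\<^sub>R real (Suc n))"
        by (metis add_diff_cancel_right' norm_triangle_ineq4)
      moreover have "norm (b /\<^sub>R real (Suc n)) \<le> norm b"
        by (simp add: divide_inverse mult_left_le_one_le inverse_le_1_iff del: of_nat_Suc)
      ultimately show False using False by simp
    qed
    ultimately show ?thesis
      using K(2) False by (simp add: F_def)
  qed
  have "(\<lambda>n. LINT x|lborel. F n x) \<longlonglongrightarrow> (LINT x|lborel. D x b)"
  proof (rule integral_dominated_convergence)
    show "integrable lborel (\<lambda>x. M * indicator (cball (0::'a) (r + norm b)) x)"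
      using emeasure_lborel_cball_finite[of "0::'a" "r + norm b"]
      by (intro integrable_mult_right integrable_real_indicator) auto
  qed (use quot bound in auto)
  then show ?thesis
    by (simp add: F0 LIMSEQ_const_iff)
qed

text \<open>Integration by parts: the product of the linear function with \<phi> has compact
  support, so its partial derivatives have integral 0, and the product rule splits them into the two
  pairings.\<close>

lemma has_weak_gradient_linear: "has_weak_gradient (\<lambda>z. e \<bullet> z) (\<lambda>_. e)"
  unfolding has_weak_gradient_def
proof (intro conjI allI impI)
  show "loc_integrable (\<lambda>z. e \<bullet> z)" "loc_integrable (\<lambda>_::real^2. e)"
    by (auto intro!: loc_integrable_continuous continuous_intros)
  fix \<phi> :: "real^2 \<Rightarrow> real" and i
  assume \<phi>: "test_function \<phi>"
  then have "C_k 1 \<phi>"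
    by (auto simp: test_function_def)
  then have d: "(\<phi> has_derivative frechet_derivative \<phi> (at x)) (at x)"
    and c: "continuous_on UNIV (\<lambda>x. frechet_derivative \<phi> (at x) (axis i 1))" for x
    by (auto simp: frechet_derivative_works)
  obtain K where K: "compact K" "\<And>z. z \<notin> K \<Longrightarrow> \<phi> z = 0"
    using \<phi> by (auto simp: test_function_def)
  have c\<phi>: "continuous_on UNIV \<phi>"
    by (rule test_function_continuous[OF \<phi>])
  let ?D = "\<lambda>x v. (e \<bullet> x) * frechet_derivative \<phi> (at x) v + (e \<bullet> v) * \<phi> x"
  have "((\<lambda>x. (e \<bullet> x) * \<phi> x) has_derivative ?D x) (at x)" for x
    by (rule derivative_eq_intros d refl | simp)+
  then have "(LINT x|lborel. ?D x (axis i 1)) = 0"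
    by (rule integral_directional_derivative_eq_0[where K = K])
       (use K c c\<phi> in \<open>auto intro!: continuous_intros\<close>)
  moreover have int2: "integrable lborel (\<lambda>x. e $ i * \<phi> x)"
  proof -
    have "integrable lborel (\<lambda>x. indicator K x *\<^sub>R (e $ i * \<phi> x))"
      using K c\<phi> by (intro borel_integrable_compact) (auto intro!: continuous_intros intro: continuous_on_subset)
    also have "(\<lambda>x. indicator K x *\<^sub>R (e $ i * \<phi> x)) = (\<lambda>x. e $ i * \<phi> x)"
      using K by (auto simp: indicator_def fun_eq_iff)
    finally show ?thesis .
  qed
  moreover have int1: "integrable lborel (\<lambda>x. (e \<bullet> x) * frechet_derivative \<phi> (at x) (axis i 1))"
  proof -
    \<comment> \<open>The complement of K is open, so \<phi> vanishes near x and its derivative also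
      has support in K; this gives integrability.\<close>
    have "frechet_derivative \<phi> (at x) = (\<lambda>_. 0)" if "x \<notin> K" for x
    proof (rule frechet_derivative_eq)
      have "((\<lambda>_. 0::real) has_derivative (\<lambda>_. 0)) (at x)" by simp
      then show "(\<phi> has_derivative (\<lambda>_. 0)) (at x)"
        by (rule has_derivative_transform_within_open[where s = "- K"])
           (use that K compact_imp_closed in auto)
    qed
    then have *: "(\<lambda>x. indicator K x *\<^sub>R ((e \<bullet> x) * frechet_derivative \<phi> (at x) (axis i 1))) =
        (\<lambda>x. (e \<bullet> x) * frechet_derivative \<phi> (at x) (axis i 1))"
      by (auto simp: indicator_def fun_eq_iff)
    have "integrable lborel (\<lambda>x. indicator K x *\<^sub>R ((e \<bullet> x) * frechet_derivative \<phi> (at x) (axis i 1)))"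
      using K c by (intro borel_integrable_compact) (auto intro!: continuous_intros intro: continuous_on_subset)
    then show ?thesis by (simp only: *)
  qed
  ultimately have "(LINT x|lborel. (e \<bullet> x) * frechet_derivative \<phi> (at x) (axis i 1)) =
      - (LINT x|lborel. e $ i * \<phi> x)"
    by (simp add: inner_axis Bochner_Integration.integral_add)
  then show "(LINT z|lebesgue. e \<bullet> z * frechet_derivative \<phi> (at z) (axis i 1)) =
      - (LINT z|lebesgue. e $ i * \<phi> z)"
    using borel_measurable_integrable[OF int1] borel_measurable_continuous_onI[OF c\<phi>]
    by (simp add: integral_completion)
qed

section \<open>The intrinsic distance\<close>

text \<open>The rescaled bump has primitive R(c (s - a)), which climbs from 0 to 1 over an interval
  of length 1/c. The integral is taken in the extended reals to fit the product formula in the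
  plane.\<close>

lemma nn_integral_smooth_bump:
  fixes R \<rho> :: "real \<Rightarrow> real"
  assumes R: "\<And>x. (R has_real_derivative \<rho> x) (at x)" and \<rho>: "continuous_on UNIV \<rho>"
    "\<And>x. 0 \<le> \<rho> x" "\<And>x. x \<notin> {0..1} \<Longrightarrow> \<rho> x = 0" and R01: "R 0 = 0" "R 1 = 1" and "0 < c"
  shows "(\<integral>\<^sup>+s. ennreal (c * \<rho> (c * (s - a))) \<partial>lborel) = 1"
proof -
  have z: "\<rho> (c * (s - a)) = 0" if "s \<notin> {a..a + 1 / c}" for s
    using that \<open>0 < c\<close> by (intro \<rho>(3)) (auto simp: field_simps zero_le_mult_iff)
  have "(\<integral>\<^sup>+s. ennreal (c * \<rho> (c * (s - a))) \<partial>lborel) =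
      (\<integral>\<^sup>+s. ennreal (c * \<rho> (c * (s - a))) * indicator {a..a + 1 / c} s \<partial>lborel)"
    using z by (intro nn_integral_cong) (auto simp: indicator_def)
  also have "\<dots> = ennreal (R (c * (a + 1 / c - a)) - R (c * (a - a)))"
  proof (rule nn_integral_FTC_Icc)
    show "(\<lambda>s. c * \<rho> (c * (s - a))) \<in> borel_measurable borel"
      by (intro borel_measurable_continuous_onI continuous_on_mult continuous_on_const
          continuous_on_compose2[OF \<rho>(1)] continuous_intros) auto
    have "((\<lambda>s. R (c * (s - a))) has_real_derivative \<rho> (c * (s - a)) * c) (at s)" for s
      by (rule DERIV_chain2[OF R]) (auto intro!: derivative_eq_intros)
    then show "((\<lambda>s. R (c * (s - a))) has_real_derivative c * \<rho> (c * (s - a))) (at s)" for s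
      by (simp add: mult.commute)
  qed (use \<rho>(2) \<open>0 < c\<close> in auto)
  also have "\<dots> = 1"
    using R01 \<open>0 < c\<close> by simp
  finally show ?thesis .
qed

lemma weighted_average_close:
  fixes u \<psi> :: "'a \<Rightarrow> real"
  assumes int: "integrable M (\<lambda>z. u z * \<psi> z)" "integrable M \<psi>" and one: "(\<integral>z. \<psi> z \<partial>M) = 1"
    and nonneg: "\<And>z. 0 \<le> \<psi> z" and close: "\<And>z. \<psi> z \<noteq> 0 \<Longrightarrow> \<bar>u z - c\<bar> \<le> \<eta>"
  shows "\<bar>(\<integral>z. u z * \<psi> z \<partial>M) - c\<bar> \<le> \<eta>"
proof -
  have "(\<integral>z. u z * \<psi> z \<partial>M) - c = (\<integral>z. u z * \<psi> z - c * \<psi> z \<partial>M)"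
    using int one by simp
  also have "\<bar>\<dots>\<bar> \<le> (\<integral>z. \<bar>u z * \<psi> z - c * \<psi> z\<bar> \<partial>M)"
    by (rule integral_abs_bound)
  also have "\<dots> \<le> (\<integral>z. \<eta> * \<psi> z \<partial>M)"
  proof (rule integral_mono)
    fix z
    have "\<bar>u z - c\<bar> * \<psi> z \<le> \<eta> * \<psi> z"
      using close[of z] nonneg[of z] by (cases "\<psi> z = 0") (auto intro: mult_right_mono)
    then show "\<bar>u z * \<psi> z - c * \<psi> z\<bar> \<le> \<eta> * \<psi> z"
      using nonneg[of z] by (simp add: left_diff_distrib[symmetric] abs_mult)
  qed (use int in auto)
  also have "\<dots> = \<eta>"
    using one by simp
  finally show ?thesis .
qed

text \<open>Testing the weak gradient against a smoothed segment recovers the increment of \<open>u\<close> along it.\<close>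

lemma weak_gradient_segment_bound:
  fixes u :: "real^2 \<Rightarrow> real" and g :: "real^2 \<Rightarrow> real^2" and i j :: 2
  assumes u: "continuous_on UNIV u" and g: "has_weak_gradient u g" and ij: "i \<noteq> j"
    and "open G" and bound: "AE z in lebesgue. z $ j \<in> G \<longrightarrow> \<bar>g z $ i\<bar> \<le> 1"
    and x: "x $ j \<in> G" and "0 \<le> t"
  shows "\<bar>u x - u (x + axis i t)\<bar> \<le> t"
proof (rule field_le_epsilon)
  fix e :: real assume "0 < e"
  \<comment> \<open>Three errors of size \<eta> will occur: one for the average of u at each end of
    the segment, and one for the extra length w.\<close>
  define \<eta> where "\<eta> = e / 3"
  have "0 < \<eta>" using \<open>0 < e\<close> by (simp add: \<eta>_def)
  define x' where "x' = x + axis i t"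
  have x'_j: "x' $ j = x $ j" and x'_i: "x' $ i = x $ i + t"
    using ij by (auto simp: x'_def axis_def)
  have cases_ij: "k = i \<or> k = j" for k
    using ij exhaust_2[of i] exhaust_2[of j] exhaust_2[of k] by auto
  obtain R \<rho> :: "real \<Rightarrow> real" where
    R: "\<And>x. (R has_real_derivative \<rho> x) (at x)" "\<And>k. C_k k R" "\<And>k. C_k k \<rho>"
    "\<And>x. 0 \<le> \<rho> x" "\<And>x. x \<notin> {0..1} \<Longrightarrow> \<rho> x = 0"
    "\<And>x. x \<le> 0 \<Longrightarrow> R x = 0" "\<And>x. 1 \<le> x \<Longrightarrow> R x = 1" "\<And>x. 0 \<le> R x" "\<And>x. R x \<le> 1"
    by (rule smooth_step_exists, rule that; assumption)
  have c\<rho>: "continuous_on UNIV \<rho>"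
    using R(3)[of 0] by simp
  obtain d1 where d1: "0 < d1" "\<And>z. dist z x < d1 \<Longrightarrow> \<bar>u z - u x\<bar> \<le> \<eta>"
    using u \<open>0 < \<eta>\<close> unfolding continuous_on_iff dist_real_def by (meson UNIV_I less_imp_le)
  obtain d2 where d2: "0 < d2" "\<And>z. dist z x' < d2 \<Longrightarrow> \<bar>u z - u x'\<bar> \<le> \<eta>"
    using u \<open>0 < \<eta>\<close> unfolding continuous_on_iff dist_real_def by (meson UNIV_I less_imp_le)
  obtain d3 where d3: "0 < d3" "\<And>s. dist s (x $ j) < d3 \<Longrightarrow> s \<in> G"
    using \<open>open G\<close> x unfolding open_dist by blast
  \<comment> \<open>The bumps live on intervals of length w, so their products live within distance
    2 w of the base point, which must stay below d1 and d2.\<close>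
  define w where "w = min (min d1 d2) (min d3 \<eta>) / 3"
  have w: "0 < w" "2 * w < d1" "2 * w < d2" "w < d3" "w \<le> \<eta>"
    using d1 d2 d3 \<open>0 < \<eta>\<close> by (auto simp: w_def min_def)
  define c where "c = 1 / w"
  have "0 < c" "1 / c = w" using w by (auto simp: c_def)
  have sc: "c * s \<notin> {0..1}" if "s \<notin> {0..w}" for s
    using that w by (auto simp: c_def field_simps zero_le_divide_iff)
  define b where "b a s = c * \<rho> (c * (s - a))" for a s
  have b0: "b a s = 0" if "s \<notin> {a..a + w}" for a s
    using R(5)[OF sc[of "s - a"]] that by (auto simp: b_def)
  have b_nonneg: "0 \<le> b a s" for a s
    using R(4) \<open>0 < c\<close> by (simp add: b_def)
  have C_b: "C_k k (b a)" for k a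
  proof -
    have "C_k k (\<lambda>s. c * \<rho> (- c * a + s \<bullet> c))"
      by (intro C_k_mult C_k_const C_k_compose_affine R)
    then show ?thesis
      by (simp add: b_def[abs_def] algebra_simps)
  qed
  have b_cont: "continuous_on UNIV (b a)" for a
    using C_b[of 0 a] by simp
  have b_meas[measurable]: "b a \<in> borel_measurable borel" for a
    by (rule borel_measurable_continuous_onI[OF b_cont])
  have b_int: "(\<integral>\<^sup>+s. ennreal (b a s) \<partial>lborel) = 1" for a
    unfolding b_def
    by (rule nn_integral_smooth_bump[OF R(1) c\<rho> R(4,5) R(6)[OF order_refl] R(7)[OF order_refl] \<open>0 < c\<close>])
  \<comment> \<open>A smooth step of width w at the start of the segment minus the same step at its
    end; the support lies in an interval of length t + w.\<close>
  define A where "A s = R (c * (s - x $ i)) - R (c * (s - x' $ i))" for s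
  have C_A: "C_k k A" for k
  proof -
    have "C_k k (\<lambda>s. R (- c * x $ i + s \<bullet> c) + (-1) * R (- c * x' $ i + s \<bullet> c))"
      by (intro C_k_add C_k_mult C_k_const C_k_compose_affine R)
    then show ?thesis
      by (simp add: A_def[abs_def] algebra_simps)
  qed
  have A0: "A s = 0" if "s \<notin> {x $ i..x $ i + (t + w)}" for s
  proof (cases "s < x $ i")
    case True
    then show ?thesis
      unfolding A_def using \<open>0 < c\<close> \<open>0 \<le> t\<close> x'_i
      by (subst (1 2) R(6)) (auto simp: mult_le_0_iff)
  next
    case False
    then have "w \<le> s - x $ i" "w \<le> s - x' $ i"
      using that \<open>0 \<le> t\<close> x'_i by auto
    then have "1 \<le> c * (s - x $ i)" "1 \<le> c * (s - x' $ i)"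
      using w by (auto simp: c_def field_simps)
    then show ?thesis
      unfolding A_def by (simp add: R(7))
  qed
  have A1: "\<bar>A s\<bar> \<le> 1" for s
    using R(8,9)[of "c * (s - x $ i)"] R(8,9)[of "c * (s - x' $ i)"] by (auto simp: A_def)
  have dA: "(A has_real_derivative (b (x $ i) s - b (x' $ i) s)) (at s)" for s
  proof -
    have "((\<lambda>s. R (c * (s - a))) has_real_derivative \<rho> (c * (s - a)) * c) (at s)" for a
      by (rule DERIV_chain2[OF R(1)]) (auto intro!: derivative_eq_intros)
    from DERIV_diff[OF this[of "x $ i"] this[of "x' $ i"]] show ?thesis
      by (simp add: A_def[abs_def] b_def mult.commute)
  qed
  \<comment> \<open>A cutoff along the segment times a bump of mass one across it. Its partial
    derivative in direction i is a mollifier at x minus the same mollifier at x', so pairing it with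
    u compares two averages of u.\<close>
  define \<phi> where "\<phi> z = A (z $ i) * b (x $ j) (z $ j)" for z :: "real^2"
  have test: "test_function \<phi>"
    unfolding \<phi>_def by (rule test_function_product[OF C_A C_b ij A0 b0])
  have d\<phi>: "frechet_derivative \<phi> (at z) (axis i 1) =
      (b (x $ i) (z $ i) - b (x' $ i) (z $ i)) * b (x $ j) (z $ j)" for z
    unfolding \<phi>_def using C_b[of 1] by (intro partial_derivative_product dA ij) auto
  define \<psi> where "\<psi> y z = b (y $ i) (z $ i) * b (y $ j) (z $ j)" for y z :: "real^2"
  have \<psi>: "integrable lebesgue (\<lambda>z. u z * \<psi> y z)" "integrable lebesgue (\<psi> y)"
    "(LINT z|lebesgue. \<psi> y z) = 1" "\<And>z. 0 \<le> \<psi> y z" for y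
  proof -
    have t\<psi>: "test_function (\<psi> y)"
      unfolding \<psi>_def by (rule test_function_product[OF C_b C_b ij b0 b0])
    then obtain K where K: "compact K" "\<And>z. z \<notin> K \<Longrightarrow> \<psi> y z = 0"
      unfolding test_function_def by blast
    show "integrable lebesgue (\<lambda>z. u z * \<psi> y z)"
      by (rule integrable_loc_integrable_times[OF loc_integrable_continuous[OF u]
            test_function_continuous[OF t\<psi>] K])
    have "integrable lebesgue (\<lambda>z. 1 * \<psi> y z)"
      by (rule integrable_loc_integrable_times[OF loc_integrable_continuous
            test_function_continuous[OF t\<psi>] K]) auto
    then show "integrable lebesgue (\<psi> y)" by simp
    show nn: "0 \<le> \<psi> y z" for z
      by (simp add: \<psi>_def b_nonneg)
    have [measurable]: "\<psi> y \<in> borel_measurable lborel"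
      by (auto intro: borel_measurable_continuous_onI test_function_continuous t\<psi>)
    have "(\<integral>\<^sup>+z. ennreal (\<psi> y z) \<partial>lborel) = (\<integral>\<^sup>+z. ennreal (b (y $ i) (z $ i)) * ennreal (b (y $ j) (z $ j)) \<partial>lborel)"
      by (simp add: \<psi>_def ennreal_mult b_nonneg)
    also have "\<dots> = 1"
      by (subst nn_integral_vec2_prod[OF _ _ ij]) (auto simp: b_int)
    finally have "(LINT z|lborel. \<psi> y z) = 1"
      by (subst integral_eq_nn_integral) (auto simp: nn)
    then show "(LINT z|lebesgue. \<psi> y z) = 1"
      by (simp add: integral_completion)
  qed
  have \<psi>_supp: "dist z y \<le> 2 * w" if "\<psi> y z \<noteq> 0" for y z
  proof -
    have "z $ i \<in> {y $ i..y $ i + w}" "z $ j \<in> {y $ j..y $ j + w}"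
      using that b0[of "z $ i" "y $ i"] b0[of "z $ j" "y $ j"] unfolding \<psi>_def by force+
    then have "\<bar>(z - y) $ k\<bar> \<le> w" for k
      using cases_ij[of k] by auto
    then have "(\<Sum>k\<in>UNIV. \<bar>(z - y) $ k\<bar>) \<le> (\<Sum>k\<in>(UNIV :: 2 set). w)"
      by (intro sum_mono) auto
    then show ?thesis
      using norm_le_l1_cart[of "z - y"] by (simp add: dist_norm)
  qed
  have near_x: "\<bar>(LINT z|lebesgue. u z * \<psi> x z) - u x\<bar> \<le> \<eta>"
    using \<psi>_supp[of x] d1(2) w by (intro weighted_average_close \<psi>) (meson le_less_trans)
  have near_x': "\<bar>(LINT z|lebesgue. u z * \<psi> x' z) - u x'\<bar> \<le> \<eta>"
    using \<psi>_supp[of x'] d2(2) w by (intro weighted_average_close \<psi>) (meson le_less_trans)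
  have "(LINT z|lebesgue. u z * \<psi> x z) - (LINT z|lebesgue. u z * \<psi> x' z) =
      (LINT z|lebesgue. u z * frechet_derivative \<phi> (at z) (axis i 1))"
    unfolding d\<phi> by (subst Bochner_Integration.integral_diff[symmetric, OF \<psi>(1) \<psi>(1)])
      (simp add: \<psi>_def x'_j algebra_simps)
  also have "\<dots> = - (LINT z|lebesgue. g z $ i * \<phi> z)"
    using g test unfolding has_weak_gradient_def by blast
  finally have diff: "\<bar>(LINT z|lebesgue. u z * \<psi> x z) - (LINT z|lebesgue. u z * \<psi> x' z)\<bar> =
      \<bar>LINT z|lebesgue. g z $ i * \<phi> z\<bar>"
    by simp
  obtain K where K: "compact K" "\<And>z. z \<notin> K \<Longrightarrow> \<phi> z = 0"
    using test unfolding test_function_def by blast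
  have int_g: "integrable lebesgue (\<lambda>z. g z $ i * \<phi> z)"
    using g by (intro integrable_loc_integrable_times[OF _ test_function_continuous[OF test] K]
      loc_integrable_component) (auto simp: has_weak_gradient_def)
  \<comment> \<open>Across the segment the bump has mass 1, along it the cutoff is at most 1 on a
    length t + w, and w < d3 keeps the support in the strip over \<open>G\<close>, where the
    gradient component is at most 1.\<close>
  have "ennreal \<bar>LINT z|lebesgue. g z $ i * \<phi> z\<bar> \<le> (\<integral>\<^sup>+z. ennreal \<bar>g z $ i * \<phi> z\<bar> \<partial>lebesgue)"
    using integral_norm_bound_ennreal[OF int_g] by simp
  also have "\<dots> \<le> (\<integral>\<^sup>+z. indicator {x $ i..x $ i + (t + w)} (z $ i) * ennreal (b (x $ j) (z $ j)) \<partial>lebesgue)"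
  proof (rule nn_integral_mono_AE)
    from bound show "AE z in lebesgue. ennreal \<bar>g z $ i * \<phi> z\<bar> \<le>
        indicator {x $ i..x $ i + (t + w)} (z $ i) * ennreal (b (x $ j) (z $ j))"
    proof eventually_elim
      fix z assume z: "z $ j \<in> G \<longrightarrow> \<bar>g z $ i\<bar> \<le> 1"
      show "ennreal \<bar>g z $ i * \<phi> z\<bar> \<le> indicator {x $ i..x $ i + (t + w)} (z $ i) * ennreal (b (x $ j) (z $ j))"
      proof (cases "\<phi> z = 0")
        case False
        then have "z $ i \<in> {x $ i..x $ i + (t + w)}" "z $ j \<in> {x $ j..x $ j + w}"
          using A0[of "z $ i"] b0[of "z $ j" "x $ j"] unfolding \<phi>_def by force+
        moreover from this have "z $ j \<in> G"
          using w by (intro d3) (auto simp: dist_real_def)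
        moreover have "\<bar>A (z $ i)\<bar> * b (x $ j) (z $ j) \<le> 1 * b (x $ j) (z $ j)"
          by (intro mult_right_mono A1 b_nonneg)
        then have "\<bar>\<phi> z\<bar> \<le> b (x $ j) (z $ j)"
          by (simp add: \<phi>_def abs_mult b_nonneg)
        ultimately have "\<bar>g z $ i\<bar> * \<bar>\<phi> z\<bar> \<le> 1 * b (x $ j) (z $ j)"
          using z by (intro mult_mono) auto
        then show ?thesis
          using \<open>z $ i \<in> _\<close> by (simp add: abs_mult ennreal_leI)
      qed simp
    qed
  qed
  also have "\<dots> = (\<integral>\<^sup>+z. indicator {x $ i..x $ i + (t + w)} (z $ i) * ennreal (b (x $ j) (z $ j)) \<partial>lborel)"
    by (rule nn_integral_completion)
  also have "\<dots> = ennreal (t + w)"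
    by (subst nn_integral_vec2_prod[OF _ _ ij]) (use \<open>0 \<le> t\<close> w in \<open>auto simp: b_int\<close>)
  finally have "\<bar>LINT z|lebesgue. g z $ i * \<phi> z\<bar> \<le> t + w"
    using \<open>0 \<le> t\<close> w by (subst (asm) ennreal_le_iff) auto
  with near_x near_x' diff w have "\<bar>u x - u x'\<bar> \<le> t + 3 * \<eta>"
    by linarith
  then show "\<bar>u x - u (x + axis i t)\<bar> \<le> t + e"
    by (simp add: x'_def \<eta>_def)
qed

section \<open>Competitors for the distance and its two-sided bounds\<close>

definition admissible :: "real \<Rightarrow> (real^2 \<Rightarrow> real) \<Rightarrow> bool" where
  "admissible \<delta> u \<longleftrightarrow>
     W12_loc u \<and> continuous_on UNIV u \<and> (AE z in lebesgue. energy_density \<delta> u z \<le> 1)"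

text \<open>Off \<open>E\<close> the weight is 1, and the complement of \<open>E\<close> contains a dense set of axis-parallel lines.\<close>

lemma admissible_axis:
  assumes u: "admissible \<delta> u" and "0 \<le> t"
  shows "\<bar>u x - u (x + axis i t)\<bar> \<le> t"
proof -
  obtain g where g: "has_weak_gradient u g"
    using u by (auto simp: admissible_def W12_loc_def)
  \<comment> \<open>The other coordinate: it is constant along lines in direction i, and such a line
    misses E as soon as its value lies outside the Cantor set.\<close>
  obtain j :: 2 where ij: "i \<noteq> j"
    using exhaust_2[of i] by (metis one_neq_zero zero_neq_one num1_eq1 exhaust_2)
  have cont: "continuous_on UNIV u"
    using u by (simp add: admissible_def)
  have "AE z in lebesgue. energy_density \<delta> u z \<le> 1"
    using u by (simp add: admissible_def)
  with energy_density_eq[OF g, of \<delta>]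
  have *: "AE z in lebesgue. z $ j \<in> - cantor_F \<longrightarrow> \<bar>g z $ i\<bar> \<le> 1"
  proof eventually_elim
    case (elim z)
    show ?case
    proof
      assume "z $ j \<in> - cantor_F"
      then have "z \<notin> set_E"
        using exhaust_2[of j] by (auto simp: set_E_def)
      with elim have "(norm (g z))\<^sup>2 \<le> 1"
        by simp
      then have "norm (g z) \<le> 1"
        by (simp add: power_le_one_iff abs_square_le_1)
      then show "\<bar>g z $ i\<bar> \<le> 1"
        using component_le_norm_cart[of "g z" i] by simp
    qed
  qed
  have seg: "\<bar>u y - u (y + axis i t)\<bar> \<le> t" if "y $ j \<notin> cantor_F" for y
    using that closed_cantor_F \<open>0 \<le> t\<close>
    by (intro weak_gradient_segment_bound[OF cont g ij _ *]) (auto simp: open_Compl)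
  show ?thesis
  proof (rule field_le_epsilon)
    fix e :: real assume "0 < e"
    have "continuous_on UNIV (\<lambda>y. \<bar>u y - u (y + axis i t)\<bar>)"
      by (intro continuous_intros continuous_on_compose2[OF cont]) (auto intro: cont)
    then obtain d where d: "0 < d" "\<And>y. dist y x < d \<Longrightarrow>
        dist \<bar>u y - u (y + axis i t)\<bar> \<bar>u x - u (x + axis i t)\<bar> < e"
      using \<open>0 < e\<close> unfolding continuous_on_iff by (meson UNIV_I)
    obtain s where s: "s \<notin> cantor_F" "\<bar>s - x $ j\<bar> < d"
      using complement_cantor_F_dense[OF d(1)] by blast
    \<comment> \<open>Moving x in coordinate j alone, by less than d, puts the whole segment on a
      line that misses E; continuity of the increment makes the cost at most e.\<close>
    define y where "y = x + axis j (s - x $ j)"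
    have "dist y x < d"
      using s by (simp add: y_def dist_norm norm_eq_sqrt_inner inner_axis_axis)
    moreover have "\<bar>u y - u (y + axis i t)\<bar> \<le> t"
      using s by (intro seg) (simp add: y_def axis_def)
    ultimately show "\<bar>u x - u (x + axis i t)\<bar> \<le> t + e"
      using d(2)[of y] by (auto simp: dist_real_def)
  qed
qed

lemma admissible_axis_real:
  assumes u: "admissible \<delta> u" shows "\<bar>u x - u (x + axis i t)\<bar> \<le> \<bar>t\<bar>"
proof (cases "0 \<le> t")
  case False
  have "x + axis i t + axis i (- t) = x"
    by (simp add: vec_eq_iff axis_def)
  with admissible_axis[OF u, of "- t" "x + axis i t" i] False show ?thesis
    by (simp add: abs_minus_commute)
qed (use admissible_axis[OF u] in auto)

lemma L2_loc_continuous: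
  fixes f :: "real^2 \<Rightarrow> 'b::euclidean_space"
  assumes "continuous_on UNIV f" shows "L2_loc f"
proof -
  have "loc_integrable (\<lambda>z. (norm (f z))\<^sup>2)"
    by (intro loc_integrable_continuous continuous_intros assms)
  then show ?thesis
    using continuous_lebesgue_measurable[OF assms] by (simp add: L2_loc_def loc_integrable_def)
qed

lemma admissible_linear:
  assumes "norm e \<le> 1" "0 \<le> \<delta>" "\<delta> \<le> 1"
  shows "admissible \<delta> (\<lambda>z. e \<bullet> z)"
  unfolding admissible_def W12_loc_def
proof (intro conjI exI)
  show "L2_loc (\<lambda>z. e \<bullet> z)" "L2_loc (\<lambda>_::real^2. e)"
    by (intro L2_loc_continuous continuous_intros)+
  show "has_weak_gradient (\<lambda>z. e \<bullet> z) (\<lambda>_. e)"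
    by (rule has_weak_gradient_linear)
  show "continuous_on UNIV (\<lambda>z. e \<bullet> z)"
    by (intro continuous_intros)
  have le: "(1 - \<delta> * indicator set_E z) * (norm e)\<^sup>2 \<le> 1 * 1" for z
    using assms by (intro mult_mono) (auto simp: indicator_def abs_square_le_1)
  show "AE z in lebesgue. energy_density \<delta> (\<lambda>z. e \<bullet> z) z \<le> 1"
    using energy_density_eq[OF has_weak_gradient_linear[of e], of \<delta>] by eventually_elim (use le in simp)
qed

lemma intrinsic_dist_bounds:
  assumes "0 \<le> \<delta>" "\<delta> \<le> 1"
  shows "norm (x - y) \<le> intrinsic_dist \<delta> x y"
    and "intrinsic_dist \<delta> x y \<le> \<bar>x $ 1 - y $ 1\<bar> + \<bar>x $ 2 - y $ 2\<bar>"
proof -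
  have d: "intrinsic_dist \<delta> x y = Sup {u x - u y | u. admissible \<delta> u}"
    by (simp add: intrinsic_dist_def admissible_def)
  have le: "u x - u y \<le> \<bar>x $ 1 - y $ 1\<bar> + \<bar>x $ 2 - y $ 2\<bar>" if u: "admissible \<delta> u" for u
  proof -
    \<comment> \<open>The corner of the axis-parallel path from x to y.\<close>
    define z where "z = x + axis 1 (y $ 1 - x $ 1)"
    have "z + axis 2 (y $ 2 - x $ 2) = y"
      by (simp add: z_def vec_eq_iff axis_def forall_2)
    then show ?thesis
      using admissible_axis_real[OF u, of x 1 "y $ 1 - x $ 1"]
        admissible_axis_real[OF u, of z 2 "y $ 2 - x $ 2"] by (simp add: z_def)
  qed
  \<comment> \<open>The linear function in the direction of x - y realises the Euclidean distance;
    for x = y the vector is 0 since \<open>inverse 0 = 0\<close>. It also shows that the supremum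
    runs over a nonempty set.\<close>
  have adm: "admissible \<delta> (\<lambda>z. ((x - y) /\<^sub>R norm (x - y)) \<bullet> z)"
    using assms by (intro admissible_linear) (auto simp: inverse_eq_divide)
  show "intrinsic_dist \<delta> x y \<le> \<bar>x $ 1 - y $ 1\<bar> + \<bar>x $ 2 - y $ 2\<bar>"
    unfolding d using adm le by (intro cSup_least) auto
  have "((x - y) /\<^sub>R norm (x - y)) \<bullet> x - ((x - y) /\<^sub>R norm (x - y)) \<bullet> y =
      ((x - y) /\<^sub>R norm (x - y)) \<bullet> (x - y)"
    by (rule inner_diff_right[symmetric])
  also have "\<dots> = norm (x - y)"
    by (cases "x = y") (simp_all add: dot_square_norm power2_eq_square)
  finally have "norm (x - y) = ((x - y) /\<^sub>R norm (x - y)) \<bullet> x - ((x - y) /\<^sub>R norm (x - y)) \<bullet> y" ..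
  then show "norm (x - y) \<le> intrinsic_dist \<delta> x y"
    unfolding d using adm le by (intro cSup_upper) (auto intro!: bdd_aboveI)
qed

section \<open>Hausdorff measure\<close>

lemma ediam_ge: "x \<in> A \<Longrightarrow> y \<in> A \<Longrightarrow> ennreal (d x y) \<le> ediam d A"
  unfolding ediam_def by (rule SUP_upper2[of "(x, y)"]) auto

lemma ediam_le: "(\<And>x y. x \<in> A \<Longrightarrow> y \<in> A \<Longrightarrow> ennreal (d x y) \<le> c) \<Longrightarrow> ediam d A \<le> c"
  unfolding ediam_def by (rule SUP_least) auto

text \<open>The summand of \<open>hausdorff_pre\<close>. The empty set is priced separately because
  0 ^ 0 = 1 would charge it when k = 0.\<close>

definition cover_cost :: "nat \<Rightarrow> ('a \<Rightarrow> 'a \<Rightarrow> real) \<Rightarrow> 'a set \<Rightarrow> ennreal" where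
  "cover_cost k d C =
     (if C = {} then 0 else ennreal (unit_ball_vol (real k) / 2 ^ k) * ediam d C ^ k)"

lemma hausdorff_pre_le:
  assumes "A \<subseteq> (\<Union>i. C i)" "\<And>i. ediam d (C i) \<le> ennreal \<epsilon>"
  shows "hausdorff_pre k d \<epsilon> A \<le> (\<Sum>i. cover_cost k d (C i))"
  unfolding hausdorff_pre_def cover_cost_def using assms by (intro INF_lower) auto

lemma hausdorff_pre_ge:
  assumes "\<And>C. A \<subseteq> (\<Union>i. C i) \<Longrightarrow> (\<And>i. ediam d (C i) \<le> ennreal \<epsilon>) \<Longrightarrow> m \<le> (\<Sum>i. cover_cost k d (C i))"
  shows "m \<le> hausdorff_pre k d \<epsilon> A"
  unfolding hausdorff_pre_def cover_cost_def[symmetric] using assms by (intro INF_greatest) auto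

lemma hausdorff_pre_antimono: "\<epsilon> \<le> \<epsilon>' \<Longrightarrow> hausdorff_pre k d \<epsilon>' A \<le> hausdorff_pre k d \<epsilon> A"
  by (intro hausdorff_pre_ge hausdorff_pre_le) (auto intro: order_trans[OF _ ennreal_leI])

lemma hausdorff_pre_mono: "A \<subseteq> B \<Longrightarrow> hausdorff_pre k d \<epsilon> A \<le> hausdorff_pre k d \<epsilon> B"
  by (intro hausdorff_pre_ge hausdorff_pre_le) auto

lemma hausdorff_pre_empty: "hausdorff_pre k d \<epsilon> {} = 0"
  using hausdorff_pre_le[of "{}" "\<lambda>_. {}" d \<epsilon> k] by (auto simp: ediam_def cover_cost_def)

text \<open>Near-optimal covers of the sets A n, with excess e / 2^(n+1), are merged into one
  sequence by the pairing function on the naturals.\<close>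

lemma hausdorff_pre_countably_subadditive:
  "hausdorff_pre k d \<epsilon> (\<Union>n. A n) \<le> (\<Sum>n. hausdorff_pre k d \<epsilon> (A n))"
proof (rule ennreal_le_epsilon)
  fix e :: real
  assume fin: "(\<Sum>n. hausdorff_pre k d \<epsilon> (A n)) < top" and "0 < e"
  have "\<exists>C. A n \<subseteq> (\<Union>i. C i) \<and> (\<forall>i. ediam d (C i) \<le> ennreal \<epsilon>) \<and>
      (\<Sum>i. cover_cost k d (C i)) \<le> hausdorff_pre k d \<epsilon> (A n) + ennreal (e * (1/2) ^ Suc n)" for n
  proof -
    have "hausdorff_pre k d \<epsilon> (A n) < top"
      using fin by (metis ennreal_suminf_lessD)
    \<comment> \<open>Finiteness makes this strict, and a strict bound on an infimum yields an
      actual cover.\<close>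
    then have "hausdorff_pre k d \<epsilon> (A n) < hausdorff_pre k d \<epsilon> (A n) + ennreal (e * (1/2) ^ Suc n)"
      using \<open>0 < e\<close> by (simp add: ennreal_add_left_cancel_less[of _ 0, simplified] less_top)
    then have "(INF C \<in> {C. A n \<subseteq> (\<Union>i. C i) \<and> (\<forall>i. ediam d (C i) \<le> ennreal \<epsilon>)}.
        \<Sum>i. cover_cost k d (C i)) < hausdorff_pre k d \<epsilon> (A n) + ennreal (e * (1/2) ^ Suc n)"
      unfolding hausdorff_pre_def cover_cost_def .
    then show ?thesis
      unfolding INF_less_iff by (auto intro: less_imp_le)
  qed
  then obtain C where C: "\<And>n. A n \<subseteq> (\<Union>i. C n i)" "\<And>n i. ediam d (C n i) \<le> ennreal \<epsilon>"
    "\<And>n. (\<Sum>i. cover_cost k d (C n i)) \<le> hausdorff_pre k d \<epsilon> (A n) + ennreal (e * (1/2) ^ Suc n)"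
    by metis
  define D where "D m = (case prod_decode m of (n, i) \<Rightarrow> C n i)" for m
  have "(\<Union>n. A n) \<subseteq> (\<Union>m. D m)"
  proof
    fix x assume "x \<in> (\<Union>n. A n)"
    then obtain n i where "x \<in> C n i" using C(1) by blast
    then have "x \<in> D (prod_encode (n, i))" by (simp add: D_def)
    then show "x \<in> (\<Union>m. D m)" by blast
  qed
  then have "hausdorff_pre k d \<epsilon> (\<Union>n. A n) \<le> (\<Sum>m. cover_cost k d (D m))"
    by (rule hausdorff_pre_le) (auto simp: D_def C split: prod.split)
  also have "\<dots> = (\<Sum>m. case prod_decode m of (n, i) \<Rightarrow> cover_cost k d (C n i))"
    by (simp add: D_def split_def)
  also have "\<dots> = (\<Sum>n. \<Sum>i. cover_cost k d (C n i))"
    by (rule suminf_ennreal_2dimen) simp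
  also have "\<dots> \<le> (\<Sum>n. hausdorff_pre k d \<epsilon> (A n) + ennreal (e * (1/2) ^ Suc n))"
    by (intro suminf_le C(3)) auto
  also have "\<dots> = (\<Sum>n. hausdorff_pre k d \<epsilon> (A n)) + (\<Sum>n. ennreal (e * (1/2) ^ Suc n))"
    by (intro suminf_add[symmetric]) auto
  also have "(\<Sum>n. ennreal (e * (1/2) ^ Suc n)) = ennreal e"
    using sums_mult[OF power_half_series, of e] \<open>0 < e\<close> by (intro suminf_ennreal_eq) auto
  finally show "hausdorff_pre k d \<epsilon> (\<Union>n. A n) \<le> (\<Sum>n. hausdorff_pre k d \<epsilon> (A n)) + ennreal e" .
qed

lemma hausdorff_outer_mono: "A \<subseteq> B \<Longrightarrow> hausdorff_outer k d A \<le> hausdorff_outer k d B"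
  unfolding hausdorff_outer_def by (intro SUP_mono') (rule hausdorff_pre_mono)

lemma hausdorff_outer_measure_space: "outer_measure_space UNIV (hausdorff_outer k d)"
  unfolding outer_measure_space_def
proof (intro conjI)
  show "positive UNIV (hausdorff_outer k d)"
    by (simp add: positive_def hausdorff_outer_def hausdorff_pre_empty)
  show "increasing UNIV (hausdorff_outer k d)"
    by (simp add: increasing_def hausdorff_outer_mono)
  show "countably_subadditive UNIV (hausdorff_outer k d)"
    unfolding countably_subadditive_def hausdorff_outer_def
    by (intro allI impI SUP_least order_trans[OF hausdorff_pre_countably_subadditive]
        suminf_le SUP_upper) auto
qed

text \<open>A cover by sets of diameter below the separation splits into covers of the two parts.\<close>

lemma hausdorff_outer_separated:
  assumes "0 < s" and sep: "\<And>a b. a \<in> A \<Longrightarrow> b \<in> B \<Longrightarrow> s \<le> d a b"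
  shows "hausdorff_outer k d A + hausdorff_outer k d B \<le> hausdorff_outer k d (A \<union> B)"
proof -
  have *: "hausdorff_pre k d \<epsilon> A + hausdorff_pre k d \<epsilon> B \<le> hausdorff_pre k d \<epsilon> (A \<union> B)"
    if "0 < \<epsilon>" "\<epsilon> < s" for \<epsilon>
  proof (rule hausdorff_pre_ge)
    fix C :: "nat \<Rightarrow> _ set" assume C: "A \<union> B \<subseteq> (\<Union>i. C i)" "\<And>i. ediam d (C i) \<le> ennreal \<epsilon>"
    have sepC: "C i \<inter> A = {} \<or> C i \<inter> B = {}" for i
    proof (rule ccontr)
      assume "\<not> ?thesis"
      then obtain a b where ab: "a \<in> C i" "a \<in> A" "b \<in> C i" "b \<in> B" by blast
      have "ennreal s \<le> ennreal (d a b)"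
        using sep[OF ab(2,4)] by (rule ennreal_leI)
      also have "\<dots> \<le> ennreal \<epsilon>"
        using ediam_ge[OF ab(1,3)] C(2)[of i] by (rule order_trans)
      finally show False using that by simp
    qed
    define CA where "CA i = (if C i \<inter> A = {} then {} else C i)" for i
    define CB where "CB i = (if C i \<inter> B = {} then {} else C i)" for i
    have "ediam d {} = 0" by (simp add: ediam_def bot_ennreal)
    then have "hausdorff_pre k d \<epsilon> A \<le> (\<Sum>i. cover_cost k d (CA i))"
      "hausdorff_pre k d \<epsilon> B \<le> (\<Sum>i. cover_cost k d (CB i))"
      using C by (auto simp: CA_def CB_def intro!: hausdorff_pre_le) blast+
    then have "hausdorff_pre k d \<epsilon> A + hausdorff_pre k d \<epsilon> B \<le>
        (\<Sum>i. cover_cost k d (CA i)) + (\<Sum>i. cover_cost k d (CB i))"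
      by (rule add_mono)
    also have "\<dots> = (\<Sum>i. cover_cost k d (CA i) + cover_cost k d (CB i))"
      by (intro suminf_add) auto
    also have "\<dots> \<le> (\<Sum>i. cover_cost k d (C i))"
      using sepC by (intro suminf_le) (auto simp: CA_def CB_def cover_cost_def)
    finally show "hausdorff_pre k d \<epsilon> A + hausdorff_pre k d \<epsilon> B \<le> (\<Sum>i. cover_cost k d (C i))" .
  qed
  \<comment> \<open>The sum of two suprema is a supremum over a common scale, because both terms
    grow as the scale shrinks.\<close>
  have "hausdorff_outer k d A + hausdorff_outer k d B =
      (SUP \<epsilon>\<in>{0<..}. hausdorff_pre k d \<epsilon> A + hausdorff_pre k d \<epsilon> B)"
    unfolding hausdorff_outer_def
  proof (rule SUP_add_directed_ennreal[symmetric])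
    fix i j :: real assume "i \<in> {0<..}" "j \<in> {0<..}"
    then show "\<exists>k'\<in>{0<..}. hausdorff_pre k d i A + hausdorff_pre k d j B \<le>
        hausdorff_pre k d k' A + hausdorff_pre k d k' B"
      by (intro bexI[of _ "min i j"] add_mono hausdorff_pre_antimono) auto
  qed
  also have "\<dots> \<le> hausdorff_outer k d (A \<union> B)"
  proof (rule SUP_least)
    fix \<epsilon> :: real assume "\<epsilon> \<in> {0<..}"
    then have \<epsilon>: "0 < min \<epsilon> (s / 2)" "min \<epsilon> (s / 2) < s"
      using \<open>0 < s\<close> by auto
    have "hausdorff_pre k d \<epsilon> A + hausdorff_pre k d \<epsilon> B \<le>
        hausdorff_pre k d (min \<epsilon> (s / 2)) A + hausdorff_pre k d (min \<epsilon> (s / 2)) B"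
      by (intro add_mono hausdorff_pre_antimono) auto
    also have "\<dots> \<le> hausdorff_pre k d (min \<epsilon> (s / 2)) (A \<union> B)"
      by (rule *[OF \<epsilon>])
    also have "\<dots> \<le> hausdorff_outer k d (A \<union> B)"
      unfolding hausdorff_outer_def using \<epsilon> by (intro SUP_upper) auto
    finally show "hausdorff_pre k d \<epsilon> A + hausdorff_pre k d \<epsilon> B \<le> hausdorff_outer k d (A \<union> B)" .
  qed
  finally show ?thesis .
qed

text \<open>Caratheodory's criterion. The distance shells around \<open>C\<close> that are two apart are separated, so
  their measures are summable and the tails of the sum tend to zero.\<close>

lemma metric_outer_measure_closed:
  fixes \<mu> :: "'a::metric_space set \<Rightarrow> ennreal"
  assumes \<mu>: "outer_measure_space UNIV \<mu>"
    and sep: "\<And>A B s. 0 < s \<Longrightarrow> (\<And>a b. a \<in> A \<Longrightarrow> b \<in> B \<Longrightarrow> s \<le> dist a b) \<Longrightarrow> \<mu> A + \<mu> B \<le> \<mu> (A \<union> B)"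
    and "closed C"
  shows "C \<in> lambda_system UNIV UNIV \<mu>"
proof -
  have mono: "\<mu> A \<le> \<mu> B" if "A \<subseteq> B" for A B
    using \<mu> that by (auto simp: outer_measure_space_def increasing_def)
  have zero: "\<mu> {} = 0"
    using \<mu> by (auto simp: outer_measure_space_def positive_def)
  have csub: "\<mu> (\<Union>i. A i) \<le> (\<Sum>i. \<mu> (A i))" for A :: "nat \<Rightarrow> 'a set"
  proof -
    \<comment> \<open>\<open>countably_subadditive\<close> is stated for disjoint families; making
      the sets disjoint extends it to arbitrary ones.\<close>
    have "\<mu> (\<Union>i. A i) = \<mu> (\<Union>i. disjointed A i)"
      by (simp add: UN_disjointed_eq)
    also have "\<dots> \<le> (\<Sum>i. \<mu> (disjointed A i))"
      using \<mu> disjoint_family_disjointed[of A]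
      by (auto simp: outer_measure_space_def countably_subadditive_def)
    also have "\<dots> \<le> (\<Sum>i. \<mu> (A i))"
      by (intro suminf_le mono disjointed_subset) auto
    finally show ?thesis .
  qed
  have sub2: "\<mu> (A \<union> B) \<le> \<mu> A + \<mu> B" for A B
  proof -
    have "\<mu> (A \<union> B) \<le> (\<Sum>i. \<mu> (binaryset A B i))"
      using csub[of "binaryset A B"] by (simp add: UN_binaryset_eq)
    also have "\<dots> = \<mu> A + \<mu> B"
      by (rule suminf_binaryset_eq) (rule zero)
    finally show ?thesis .
  qed
  \<comment> \<open>The empty set is treated apart because \<open>infdist\<close> to it is
    constantly 0 and does not detect its complement.\<close>
  have ge: "\<mu> (C \<inter> T) + \<mu> ((UNIV - C) \<inter> T) \<le> \<mu> T" for T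
  proof (cases "\<mu> T = top \<or> C = {}")
    case True
    then show ?thesis using zero by auto
  next
    case False
    then have T: "\<mu> T < top" and "C \<noteq> {}" by (auto simp: less_top)
    define g where "g x = infdist x C" for x
    have g_lip: "g x \<le> g y + dist x y" for x y
      unfolding g_def by (rule infdist_triangle)
    have g_pos: "0 < g x" if "x \<notin> C" for x
      using that \<open>closed C\<close> \<open>C \<noteq> {}\<close> infdist_nonneg[of x C] in_closed_iff_infdist_zero[of C x]
      by (auto simp: g_def)
    have g_C: "g c = 0" if "c \<in> C" for c
      using that by (simp add: g_def)
    define r where "r n = 1 / real (Suc n)" for n
    have r: "0 < r n" "r (Suc n) < r n" for n
      by (auto simp: r_def field_simps)
    have r_anti: "r n \<le> r m" if "m \<le> n" for m n
      using that by (auto simp: r_def field_simps)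
    define S where "S n = {x \<in> T. r n \<le> g x}" for n
    define Q where "Q n = {x \<in> T. r (Suc n) \<le> g x \<and> g x < r n}" for n
    have Q_sum: "(\<Sum>i<N. \<mu> (Q (2 * i + j))) \<le> \<mu> (\<Union>i<N. Q (2 * i + j))" for N j
    proof (induction N)
      case (Suc N)
      show ?case
      proof (cases N)
        case (Suc M)
        have "\<mu> (\<Union>i<N. Q (2 * i + j)) + \<mu> (Q (2 * N + j)) \<le> \<mu> ((\<Union>i<N. Q (2 * i + j)) \<union> Q (2 * N + j))"
        proof (rule sep)
          \<comment> \<open>The thickness of the skipped shell: earlier shells have g \<ge> r (2 M +
            j + 1), the new one has g < r (2 N + j) with N = M + 1, and g is 1-Lipschitz.\<close>
          show "0 < r (2 * M + j + 1) - r (2 * N + j)"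
            using r(2)[of "2 * M + j + 1"] Suc by simp
          fix a b assume "a \<in> (\<Union>i<N. Q (2 * i + j))" "b \<in> Q (2 * N + j)"
          then obtain i where i: "i < N" "r (Suc (2 * i + j)) \<le> g a" "g b < r (2 * N + j)"
            by (auto simp: Q_def)
          have "r (2 * M + j + 1) \<le> r (Suc (2 * i + j))"
            using i(1) Suc by (intro r_anti) auto
          with i g_lip[of a b] show "r (2 * M + j + 1) - r (2 * N + j) \<le> dist a b"
            by simp
        qed
        moreover have "(\<Union>i<Suc N. Q (2 * i + j)) = (\<Union>i<N. Q (2 * i + j)) \<union> Q (2 * N + j)"
          by (auto simp: lessThan_Suc)
        ultimately show ?thesis
          using Suc.IH by (simp add: add_right_mono order_trans[OF add_right_mono])
      qed (simp add: lessThan_Suc)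
    qed (simp add: zero)
    have Q_sum_T: "(\<Sum>i<N. \<mu> (Q (2 * i + j))) \<le> \<mu> T" for N j
      by (rule order_trans[OF Q_sum mono]) (auto simp: Q_def)
    have "(\<Sum>n<N. \<mu> (Q n)) \<le> \<mu> T + \<mu> T" for N
    proof -
      have "(\<Sum>n<N. \<mu> (Q n)) \<le> (\<Sum>n<2 * N. \<mu> (Q n))"
        by (rule sum_mono2) auto
      also have "\<dots> = (\<Sum>i<N. \<mu> (Q (2 * i + 0))) + (\<Sum>i<N. \<mu> (Q (2 * i + 1)))"
        by (induction N) (auto simp: algebra_simps)
      also have "\<dots> \<le> \<mu> T + \<mu> T"
        by (intro add_mono Q_sum_T)
      finally show ?thesis .
    qed
    then have "(\<Sum>n. \<mu> (Q n)) \<le> \<mu> T + \<mu> T"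
      by (intro suminf_le_const) auto
    also have "\<dots> < top" using T by simp
    finally have Q_fin: "(\<Sum>n. \<mu> (Q n)) \<noteq> top" by simp
    define q where "q n = enn2real (\<mu> (Q n))" for n
    have q: "\<mu> (Q n) = ennreal (q n)" "0 \<le> q n" for n
    proof -
      have "\<mu> (Q n) \<le> \<mu> T" by (rule mono) (auto simp: Q_def)
      then show "\<mu> (Q n) = ennreal (q n)" using T by (simp add: q_def less_top)
    qed (simp add: q_def)
    have "summable q"
      using Q_fin q by (intro summable_suminf_not_top) auto
    have cover: "(UNIV - C) \<inter> T \<subseteq> S n \<union> (\<Union>i. Q (i + n))" for n
    proof
      fix x assume x: "x \<in> (UNIV - C) \<inter> T"
      show "x \<in> S n \<union> (\<Union>i. Q (i + n))"
      proof (cases "r n \<le> g x")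
        case True
        with x show ?thesis by (auto simp: S_def)
      next
        case False
        have "x \<notin> C" using x by simp
        then obtain k where "inverse (real (Suc k)) < g x"
          using reals_Archimedean g_pos by blast
        then have "r k < g x"
          by (simp add: r_def inverse_eq_divide)
        \<comment> \<open>The first radius not exceeding g x; the point lies in the shell of index m
          - 1, which is at least n.\<close>
        define m where "m = (LEAST k. r k \<le> g x)"
        have m: "r m \<le> g x"
          unfolding m_def using \<open>r k < g x\<close> by (intro LeastI[of "\<lambda>k. r k \<le> g x" k]) simp
        have "n < m"
        proof (rule ccontr)
          assume "\<not> n < m"
          then have "r n \<le> r m" by (intro r_anti) simp
          with m False show False by simp
        qed
        then obtain l where l: "m = Suc l" "n \<le> l"
          by (cases m) auto
        have "g x < r l"
          using not_less_Least[of l "\<lambda>k. r k \<le> g x"] l by (simp add: m_def[symmetric])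
        then have "x \<in> Q (l - n + n)"
          using m l x by (simp add: Q_def)
        then show ?thesis by blast
      qed
    qed
    show ?thesis
    proof (rule ennreal_le_epsilon)
      fix e :: real assume "0 < e"
      obtain n where n: "norm (\<Sum>i. q (i + n)) < e"
        using suminf_exist_split[OF \<open>0 < e\<close> \<open>summable q\<close>] by blast
      have "\<mu> ((UNIV - C) \<inter> T) \<le> \<mu> (S n) + (\<Sum>i. \<mu> (Q (i + n)))"
        using mono[OF cover[of n]] sub2[of "S n" "\<Union>i. Q (i + n)"] csub[of "\<lambda>i. Q (i + n)"]
        by (meson add_left_mono order_trans)
      also have "(\<Sum>i. \<mu> (Q (i + n))) = ennreal (\<Sum>i. q (i + n))"
        unfolding q(1) using \<open>summable q\<close> q(2)
        by (intro suminf_ennreal2) (auto intro: summable_ignore_initial_segment)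
      also have "\<dots> \<le> ennreal e"
        using n by (intro ennreal_leI) auto
      finally have 1: "\<mu> ((UNIV - C) \<inter> T) \<le> \<mu> (S n) + ennreal e"
        by (simp add: add_left_mono)
      have "\<mu> (C \<inter> T) + \<mu> (S n) \<le> \<mu> (C \<inter> T \<union> S n)"
      proof (rule sep)
        show "r n \<le> dist a b" if "a \<in> C \<inter> T" "b \<in> S n" for a b
          using that g_lip[of b a] g_C[of a] by (auto simp: S_def dist_commute)
      qed (rule r)
      also have "\<dots> \<le> \<mu> T"
        by (rule mono) (auto simp: S_def)
      finally have 2: "\<mu> (C \<inter> T) + \<mu> (S n) \<le> \<mu> T" .
      have "\<mu> (C \<inter> T) + \<mu> ((UNIV - C) \<inter> T) \<le> \<mu> (C \<inter> T) + (\<mu> (S n) + ennreal e)"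
        by (intro add_left_mono 1)
      also have "\<dots> \<le> \<mu> T + ennreal e"
        using 2 by (simp add: add_right_mono flip: add.assoc)
      finally show "\<mu> (C \<inter> T) + \<mu> ((UNIV - C) \<inter> T) \<le> \<mu> T + ennreal e" .
    qed
  qed
  show ?thesis
    unfolding lambda_system_def
  proof (intro CollectI conjI ballI UNIV_I)
    fix T
    have "T = (C \<inter> T) \<union> ((UNIV - C) \<inter> T)" by blast
    then have "\<mu> T \<le> \<mu> (C \<inter> T) + \<mu> ((UNIV - C) \<inter> T)"
      using sub2 by metis
    with ge[of T] show "\<mu> (C \<inter> T) + \<mu> ((UNIV - C) \<inter> T) = \<mu> T"
      by (rule antisym)
  qed
qed

section \<open>The Hausdorff measure on Borel sets\<close>

lemma sets_hausdorff_measure[simp, measurable_cong]: "sets (hausdorff_measure k d) = sets borel"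
  unfolding hausdorff_measure_def using sets.sets_measure_of_eq[of borel] by simp

lemma space_hausdorff_measure[simp]: "space (hausdorff_measure k d) = UNIV"
  unfolding hausdorff_measure_def by (simp add: space_measure_of_conv)

text \<open>\<open>measure_of\<close> returns the outer measure only if it is countably additive on
  the Borel sets. The bound c dist \<le> d turns separation in the metric into separation for d, so
  Caratheodory's criterion applies to all closed sets.\<close>

lemma emeasure_hausdorff_measure:
  fixes d :: "'a::metric_space \<Rightarrow> 'a \<Rightarrow> real"
  assumes "0 < c" "\<And>x y. c * dist x y \<le> d x y" and A: "A \<in> sets borel"
  shows "emeasure (hausdorff_measure k d) A = hausdorff_outer k d A"
proof -
  let ?\<mu> = "hausdorff_outer k d"
  have sa: "sigma_algebra UNIV (UNIV :: 'a set set)"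
    using sigma_algebra_Pow[of UNIV] by simp
  have \<mu>: "outer_measure_space UNIV ?\<mu>"
    by (rule hausdorff_outer_measure_space)
  let ?L = "lambda_system UNIV UNIV ?\<mu>"
  have L: "measure_space UNIV ?L ?\<mu>"
    by (rule sigma_algebra.caratheodory_lemma[OF sa \<mu>])
  have "closed C \<Longrightarrow> C \<in> ?L" for C
  proof (rule metric_outer_measure_closed[OF \<mu>])
    fix A B :: "'a set" and s :: real
    assume s: "0 < s" "\<And>a b. a \<in> A \<Longrightarrow> b \<in> B \<Longrightarrow> s \<le> dist a b"
    show "?\<mu> A + ?\<mu> B \<le> ?\<mu> (A \<union> B)"
    proof (rule hausdorff_outer_separated)
      show "c * s \<le> d a b" if "a \<in> A" "b \<in> B" for a b
        using s(2)[OF that] assms(1,2) by (meson mult_left_mono less_imp_le order_trans)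
    qed (use s assms(1) in simp)
  qed
  then have "sigma_sets UNIV (Collect closed) \<subseteq> ?L"
    using L by (intro sigma_algebra.sigma_sets_subset) (auto simp: measure_space_def)
  then have sub: "sets borel \<subseteq> ?L"
    by (simp add: borel_eq_closed)
  have "measure_space UNIV (sets borel) ?\<mu>"
    by (rule measure_down[OF L _ sub]) (metis sets.sigma_algebra_axioms space_borel)
  then have "countably_additive (sets borel) ?\<mu>" "positive (sets borel) ?\<mu>"
    by (auto simp: measure_space_def)
  then show ?thesis
    using A by (intro emeasure_measure_of[OF hausdorff_measure_def]) auto
qed

section \<open>Tangent norms between the maximum and the Euclidean norm\<close>

text \<open>For a linear function the difference quotient is |v \<bullet> (y - z)| / d y z.
  Cauchy-Schwarz and d \<ge> Euclidean bound it above; approaching z along axis i bounds the upper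
  limit below; subadditivity in v gives the third claim, which will supply continuity and hence an
  open unit ball.\<close>

lemma tangent_norm_properties:
  assumes \<delta>: "0 \<le> \<delta>" "\<delta> \<le> 1"
  shows tangent_norm_le: "tangent_norm \<delta> z v \<le> norm v"
    and tangent_norm_ge: "\<bar>v $ i\<bar> \<le> tangent_norm \<delta> z v"
    and tangent_norm_diff: "tangent_norm \<delta> z v \<le> tangent_norm \<delta> z w + norm (v - w)"
proof -
  define d where "d = intrinsic_dist \<delta>"
  have d: "norm (x - y) \<le> d x y" "d x y \<le> \<bar>x $ 1 - y $ 1\<bar> + \<bar>x $ 2 - y $ 2\<bar>" for x y
    unfolding d_def by (rule intrinsic_dist_bounds[OF \<delta>])+
  define q where "q v y = \<bar>v \<bullet> (y - z)\<bar> / d y z" for v y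
  define L where "L v = Limsup (at z) (\<lambda>y. ereal (q v y))" for v
  have N: "tangent_norm \<delta> z v = real_of_ereal (L v)" for v
    unfolding tangent_norm_def pointwise_Lip_def L_def q_def d_def
    by (simp add: inner_vec_def sum_2 algebra_simps)
  have d_nonneg: "0 \<le> d x y" for x y
    using d(1)[of x y] norm_ge_zero order_trans by blast
  have q_nonneg: "0 \<le> q v y" for v y
    by (simp add: q_def d_nonneg)
  have q_le: "q v y \<le> norm v" for v y
  proof (cases "d y z = 0")
    case False
    have "\<bar>v \<bullet> (y - z)\<bar> \<le> norm v * norm (y - z)"
      by (rule Cauchy_Schwarz_ineq2)
    also have "\<dots> \<le> norm v * d y z"
      by (intro mult_left_mono d) auto
    finally show ?thesis
      using False d_nonneg[of y z] by (simp add: q_def divide_le_eq)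
  qed (simp add: q_def)
  have q_diff: "q v y \<le> q w y + norm (v - w)" for v w y
  proof -
    have "\<bar>v \<bullet> (y - z)\<bar> \<le> \<bar>w \<bullet> (y - z)\<bar> + \<bar>(v - w) \<bullet> (y - z)\<bar>"
      by (simp add: inner_diff_left)
    then have "q v y \<le> q w y + q (v - w) y"
      unfolding q_def add_divide_distrib[symmetric] using d_nonneg by (rule divide_right_mono)
    with q_le[of "v - w" y] show ?thesis by simp
  qed
  have L_le: "L v \<le> ereal (norm v)" for v
    unfolding L_def by (intro Limsup_bounded always_eventually allI) (simp add: q_le)
  have L_ge: "ereal \<bar>v $ i\<bar> \<le> L v" for v i
    unfolding L_def Limsup_def
  proof (rule INF_greatest)
    fix P assume "P \<in> {P. eventually P (at z)}"
    then have P: "eventually P (at z)" by simp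
    \<comment> \<open>Along an axis the l1 and Euclidean distances agree, so the two bounds on d
      leave no loss.\<close>
    define y where "y n = z + axis i (1 / real (Suc n))" for n
    have yz: "y n - z = axis i (1 / real (Suc n))" for n
      by (simp add: y_def)
    have "norm (y n - z) = 1 / real (Suc n)" for n
      unfolding yz by (simp add: norm_eq_sqrt_inner inner_axis_axis real_sqrt_divide)
    then have pos: "0 < norm (y n - z)" for n
      by simp
    have q_ge: "\<bar>v $ i\<bar> \<le> q v (y n)" for n
    proof -
      have "\<bar>y n $ 1 - z $ 1\<bar> + \<bar>y n $ 2 - z $ 2\<bar> = 1 / real (Suc n)"
        using exhaust_2[of i] by (auto simp: y_def axis_def)
      then have "d (y n) z \<le> 1 / real (Suc n)"
        using d(2)[of "y n" z] by simp
      then have "\<bar>v $ i\<bar> * d (y n) z \<le> \<bar>v $ i\<bar> * (1 / real (Suc n))"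
        by (rule mult_left_mono) simp
      also have "\<dots> = \<bar>v \<bullet> (y n - z)\<bar>"
        unfolding yz by (simp add: inner_axis abs_mult)
      finally show ?thesis
        unfolding q_def using less_le_trans[OF pos d(1)] by (subst pos_le_divide_eq)
    qed
    have "filterlim y (at z) sequentially"
    proof (rule filterlim_atI)
      have "(\<lambda>n. y n - z) \<longlonglongrightarrow> 0"
        using LIMSEQ_inverse_real_of_nat \<open>\<And>n. norm (y n - z) = _\<close>
        by (subst tendsto_norm_zero_iff[symmetric]) (simp add: inverse_eq_divide)
      then show "y \<longlonglongrightarrow> z"
        by (simp add: LIM_zero_iff)
      show "\<forall>\<^sub>F n in sequentially. y n \<noteq> z"
        using pos by (intro always_eventually allI) auto
    qed
    then have "\<forall>\<^sub>F n in sequentially. P (y n)"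
      using P by (rule eventually_compose_filterlim[rotated])
    then obtain n where "P (y n)"
      using eventually_happens[of _ sequentially] by auto
    then show "ereal \<bar>v $ i\<bar> \<le> (SUP y\<in>Collect P. ereal (q v y))"
      using q_ge[of n] by (intro SUP_upper2[of "y n"]) auto
  qed
  \<comment> \<open>The two bounds exclude infinite values, so nothing is lost in
    \<open>real_of_ereal\<close>.\<close>
  have L_N: "L v = ereal (tangent_norm \<delta> z v)" for v
    using L_le[of v] L_ge[of v 1] unfolding N by (cases "L v") auto
  show "tangent_norm \<delta> z v \<le> norm v" "\<bar>v $ i\<bar> \<le> tangent_norm \<delta> z v"
    using L_le[of v] L_ge[of v i] by (simp_all add: L_N)
  have "L v \<le> Limsup (at z) (\<lambda>y. ereal (q w y) + ereal (norm (v - w)))"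
    unfolding L_def by (intro Limsup_mono always_eventually allI) (simp add: q_diff)
  also have "\<dots> = L w + ereal (norm (v - w))"
    unfolding L_def by (rule Limsup_add_ereal_right) auto
  finally show "tangent_norm \<delta> z v \<le> tangent_norm \<delta> z w + norm (v - w)"
    by (simp add: L_N)
qed

section \<open>Isometry invariance and comparison with Lebesgue measure\<close>

lemma hausdorff_outer_isometry:
  assumes "bij S" and iso: "\<And>x y. d' (S x) (S y) = d x y"
  shows "hausdorff_outer k d' (S ` A) = hausdorff_outer k d A"
proof -
  have le: "hausdorff_outer k d' (S ` A) \<le> hausdorff_outer k d A"
    if iso: "\<And>x y. d' (S x) (S y) = d x y" for S :: "'c \<Rightarrow> 'd" and d d' A
  proof -
    have ediam: "ediam d' (S ` C) = ediam d C" for C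
    proof (rule antisym)
      show "ediam d' (S ` C) \<le> ediam d C"
        by (rule ediam_le) (auto simp: iso intro: ediam_ge)
      show "ediam d C \<le> ediam d' (S ` C)"
        using ediam_ge[of "S _" "S ` C" "S _" d'] by (intro ediam_le) (simp add: iso)
    qed
    have cost: "cover_cost k d' (S ` C) = cover_cost k d C" for C
      by (cases "C = {}") (simp_all add: cover_cost_def ediam)
    have "hausdorff_pre k d' \<epsilon> (S ` A) \<le> hausdorff_pre k d \<epsilon> A" for \<epsilon>
    proof (rule hausdorff_pre_ge)
      fix C :: "nat \<Rightarrow> _ set" assume C: "A \<subseteq> (\<Union>i. C i)" "\<And>i. ediam d (C i) \<le> ennreal \<epsilon>"
      have "hausdorff_pre k d' \<epsilon> (S ` A) \<le> (\<Sum>i. cover_cost k d' (S ` C i))"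
      proof (rule hausdorff_pre_le)
        show "S ` A \<subseteq> (\<Union>i. S ` C i)"
          using C(1) by blast
      qed (simp add: ediam C(2))
      then show "hausdorff_pre k d' \<epsilon> (S ` A) \<le> (\<Sum>i. cover_cost k d (C i))"
        by (simp add: cost)
    qed
    then show ?thesis
      unfolding hausdorff_outer_def by (intro SUP_mono')
  qed
  have inv: "inv S (S x) = x" "S (inv S y) = y" for x y
    using \<open>bij S\<close> by (auto simp: bij_is_inj bij_is_surj surj_f_inv_f)
  have "hausdorff_outer k d (inv S ` S ` A) \<le> hausdorff_outer k d' (S ` A)"
    by (rule le) (metis iso inv(2))
  moreover have "inv S ` S ` A = A"
    by (simp add: image_image inv)
  ultimately show ?thesis
    using le[of d' S d A, OF iso] by (intro antisym) auto
qed

lemma emeasure_lborel_square: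
  fixes x :: "real^2" assumes "0 \<le> r"
  shows "emeasure lborel {y :: real^2. \<bar>y $ 1 - x $ 1\<bar> \<le> r \<and> \<bar>y $ 2 - x $ 2\<bar> \<le> r} = ennreal (4 * r\<^sup>2)"
proof -
  have "{y :: real^2. \<bar>y $ 1 - x $ 1\<bar> \<le> r \<and> \<bar>y $ 2 - x $ 2\<bar> \<le> r} =
      {y. y $ 1 \<in> {x $ 1 - r..x $ 1 + r} \<and> y $ 2 \<in> {x $ 2 - r..x $ 2 + r}}"
    by auto
  also have "emeasure lborel \<dots> = ennreal (2 * r) * ennreal (2 * r)"
    using assms by (subst emeasure_vec2_times) auto
  also have "\<dots> = ennreal (4 * r\<^sup>2)"
    using assms by (simp add: power2_eq_square flip: ennreal_mult)
  finally show ?thesis .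
qed

lemma cover_cost_2: "C \<noteq> {} \<Longrightarrow> cover_cost 2 d C = ennreal (pi / 4) * (ediam d C)\<^sup>2"
  by (simp add: cover_cost_def unit_ball_vol_2)

text \<open>A set of d-diameter r lies in the square of side 2 r about any of its points. The square
  has area 4 r^2 and the set costs (pi/4) r^2, whence the factor pi/16.\<close>

lemma hausdorff_outer_ge_lborel:
  fixes d :: "real^2 \<Rightarrow> real^2 \<Rightarrow> real"
  assumes d: "\<And>x y i. \<bar>x $ i - y $ i\<bar> \<le> d x y" and A: "A \<in> sets borel"
  shows "ennreal (pi / 16) * emeasure lborel A \<le> hausdorff_outer 2 d A"
proof -
  \<comment> \<open>One scale is enough for a lower bound on a supremum; scale 1 makes every
    diameter in the cover finite.\<close>
  have "ennreal (pi / 16) * emeasure lborel A \<le> hausdorff_pre 2 d 1 A"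
  proof (rule hausdorff_pre_ge)
    fix C :: "nat \<Rightarrow> (real^2) set" assume C: "A \<subseteq> (\<Union>i. C i)" "\<And>i. ediam d (C i) \<le> ennreal 1"
    have "\<exists>B\<in>sets borel. C i \<subseteq> B \<and> ennreal (pi / 16) * emeasure lborel B \<le> cover_cost 2 d (C i)" for i
    proof (cases "C i = {}")
      case False
      then obtain x where x: "x \<in> C i" by blast
      define r where "r = enn2real (ediam d (C i))"
      have r: "ediam d (C i) = ennreal r" "0 \<le> r"
      proof -
        have "ediam d (C i) < top"
          using C(2)[of i] by (rule le_less_trans) simp
        then show "ediam d (C i) = ennreal r" by (simp add: r_def)
      qed (simp add: r_def)
      define B where "B = {y :: real^2. \<bar>y $ 1 - x $ 1\<bar> \<le> r \<and> \<bar>y $ 2 - x $ 2\<bar> \<le> r}"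
      have "C i \<subseteq> B"
      proof
        fix y assume "y \<in> C i"
        then have "ennreal (d y x) \<le> ennreal r"
          using ediam_ge[of y "C i" x d] x r by simp
        then have "d y x \<le> r"
          using r(2) by (simp add: ennreal_le_iff)
        then show "y \<in> B"
          using d[of y 1 x] d[of y 2 x] by (auto simp: B_def)
      qed
      moreover have "ennreal (pi / 16) * emeasure lborel B \<le> cover_cost 2 d (C i)"
        unfolding cover_cost_2[OF False] r(1) B_def emeasure_lborel_square[OF r(2)]
        using r(2) by (simp add: ennreal_power flip: ennreal_mult)
      moreover have "B \<in> sets borel"
        unfolding B_def by measurable
      ultimately show ?thesis by blast
    qed (auto intro!: bexI[of _ "{}"])
    then have "\<forall>i. \<exists>B. B \<in> sets borel \<and> C i \<subseteq> B \<and>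
        ennreal (pi / 16) * emeasure lborel B \<le> cover_cost 2 d (C i)"
      by blast
    from choice[OF this] obtain B where "\<forall>i. B i \<in> sets borel \<and> C i \<subseteq> B i \<and>
        ennreal (pi / 16) * emeasure lborel (B i) \<le> cover_cost 2 d (C i)" ..
    then have B: "B i \<in> sets borel" "C i \<subseteq> B i"
      "ennreal (pi / 16) * emeasure lborel (B i) \<le> cover_cost 2 d (C i)" for i
      by simp_all
    have "emeasure lborel A \<le> emeasure lborel (\<Union>i. B i)"
    proof (rule emeasure_mono)
      show "A \<subseteq> (\<Union>i. B i)"
        by (rule order_trans[OF C(1) SUP_mono']) (rule B(2))
      show "(\<Union>i. B i) \<in> sets lborel"
        unfolding sets_lborel by (rule sets.countable_UN) (use B(1) in blast)
    qed
    also have "\<dots> \<le> (\<Sum>i. emeasure lborel (B i))"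
      using B by (intro emeasure_subadditive_countably) auto
    finally have "ennreal (pi / 16) * emeasure lborel A \<le> (\<Sum>i. ennreal (pi / 16) * emeasure lborel (B i))"
      by (simp add: mult_left_mono)
    also have "\<dots> \<le> (\<Sum>i. cover_cost 2 d (C i))"
      by (intro suminf_le B) auto
    finally show "ennreal (pi / 16) * emeasure lborel A \<le> (\<Sum>i. cover_cost 2 d (C i))" .
  qed
  also have "\<dots> \<le> hausdorff_outer 2 d A"
    unfolding hausdorff_outer_def by (intro SUP_upper) auto
  finally show ?thesis .
qed

text \<open>Cut into n^2 cells of side 2/n, the square has pieces of diameter at most 4/n by the l1
  bound, each costing at most 4 pi / n^2: the total 4 pi does not depend on the scale.\<close>

lemma hausdorff_outer_square_le:
  fixes d :: "real^2 \<Rightarrow> real^2 \<Rightarrow> real"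
  assumes d: "\<And>x y. d x y \<le> norm (x - y)"
  shows "hausdorff_outer 2 d {v. \<bar>v $ 1\<bar> < 1 \<and> \<bar>v $ 2\<bar> < 1} \<le> ennreal (4 * pi)"
  unfolding hausdorff_outer_def
proof (rule SUP_least)
  fix \<epsilon> :: real assume "\<epsilon> \<in> {0<..}"
  then obtain m where m: "inverse (real (Suc m)) < \<epsilon> / 4"
    using reals_Archimedean[of "\<epsilon> / 4"] by auto
  define n where "n = Suc m"
  have n: "0 < n" "4 / real n \<le> \<epsilon>"
    using m by (simp_all add: n_def inverse_eq_divide)
  \<comment> \<open>Covers are sequences, so the grid is numbered by one index, m = i n + j, and
    padded with empty sets.\<close>
  define cell where "cell m = (if m < n * n then {v :: real^2.
      v $ 1 \<in> {2 * real (m div n) / n - 1..2 * real (m div n + 1) / n - 1} \<and>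
      v $ 2 \<in> {2 * real (m mod n) / n - 1..2 * real (m mod n + 1) / n - 1}} else {})" for m
  have diam: "ediam d (cell m) \<le> ennreal (4 / n)" for m
  proof (rule ediam_le, rule ennreal_leI)
    fix x y assume xy: "x \<in> cell m" "y \<in> cell m"
    then have "\<bar>x $ 1 - y $ 1\<bar> \<le> 2 / n" "\<bar>x $ 2 - y $ 2\<bar> \<le> 2 / n"
      by (auto simp: cell_def add_divide_distrib abs_le_iff split: if_splits)
    then have "norm (x - y) \<le> 4 / n"
      using norm_le_l1_cart[of "x - y"] by (simp add: sum_2)
    with d[of x y] show "d x y \<le> 4 / n" by simp
  qed
  have cover: "{v. \<bar>v $ 1\<bar> < 1 \<and> \<bar>v $ 2\<bar> < 1} \<subseteq> (\<Union>m. cell m)"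
  proof
    fix v :: "real^2" assume "v \<in> {v. \<bar>v $ 1\<bar> < 1 \<and> \<bar>v $ 2\<bar> < 1}"
    then have v: "\<bar>v $ 1\<bar> < 1" "\<bar>v $ 2\<bar> < 1" by auto
    have ex: "\<exists>i<n. s \<in> {2 * real i / n - 1..2 * real (i + 1) / n - 1}" if "\<bar>s\<bar> < 1" for s
    proof -
      define t where "t = (s + 1) * n / 2"
      have t: "0 \<le> t" "t < n"
      proof -
        show "0 \<le> t"
          using that unfolding t_def by (intro divide_nonneg_nonneg mult_nonneg_nonneg) auto
        have "(s + 1) * real n < 2 * real n"
          using that n(1) by (intro mult_strict_right_mono) auto
        then show "t < n" by (simp add: t_def)
      qed
      define i where "i = nat \<lfloor>t\<rfloor>"
      have i: "real i \<le> t" "t < real i + 1"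
        using t(1) by (auto simp: i_def)
      moreover have "i < n"
        using t i(1) by linarith
      moreover have s: "s = 2 * t / n - 1"
        using n(1) by (simp add: t_def)
      ultimately have "2 * real i / n - 1 \<le> s" "s \<le> 2 * real (i + 1) / n - 1"
        unfolding s using n(1) by (auto intro!: divide_right_mono)
      with \<open>i < n\<close> show ?thesis by auto
    qed
    obtain i j where ij: "i < n" "j < n" "v $ 1 \<in> {2 * real i / n - 1..2 * real (i + 1) / n - 1}"
      "v $ 2 \<in> {2 * real j / n - 1..2 * real (j + 1) / n - 1}"
      using ex[OF v(1)] ex[OF v(2)] by blast
    have "i * n + j < n * n"
    proof -
      have "i * n + j < (i + 1) * n" using ij by simp
      also have "\<dots> \<le> n * n" using ij by (intro mult_right_mono) auto
      finally show ?thesis .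
    qed
    moreover have "(i * n + j) div n = i" "(i * n + j) mod n = j"
      using ij by auto
    ultimately have "v \<in> cell (i * n + j)"
      using ij by (simp add: cell_def)
    then show "v \<in> (\<Union>m. cell m)" by blast
  qed
  have "hausdorff_pre 2 d \<epsilon> {v. \<bar>v $ 1\<bar> < 1 \<and> \<bar>v $ 2\<bar> < 1} \<le> (\<Sum>m. cover_cost 2 d (cell m))"
    using cover by (rule hausdorff_pre_le) (rule order_trans[OF diam ennreal_leI[OF n(2)]])
  also have "\<dots> = (\<Sum>m<n * n. cover_cost 2 d (cell m))"
    by (intro suminf_finite) (auto simp: cell_def cover_cost_def)
  also have "\<dots> \<le> (\<Sum>m<n * n. ennreal (4 * pi / (n * n)))"
  proof (rule sum_mono)
    fix m
    show "cover_cost 2 d (cell m) \<le> ennreal (4 * pi / (n * n))"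
    proof (cases "cell m = {}")
      case False
      have "ennreal (pi / 4) * (ediam d (cell m))\<^sup>2 \<le> ennreal (pi / 4) * (ennreal (4 / n))\<^sup>2"
        by (intro mult_left_mono power_mono diam) auto
      also have "\<dots> = ennreal (4 * pi / (n * n))"
        by (simp add: ennreal_power power2_eq_square flip: ennreal_mult)
      finally show ?thesis by (simp add: cover_cost_2[OF False])
    qed (simp add: cover_cost_def)
  qed
  also have "\<dots> = ennreal (4 * pi)"
    using n(1) by (simp add: ennreal_of_nat_eq_real_of_nat flip: ennreal_mult)
  finally show "hausdorff_pre 2 d \<epsilon> {v. \<bar>v $ 1\<bar> < 1 \<and> \<bar>v $ 2\<bar> < 1} \<le> ennreal (4 * pi)" .
qed

section \<open>The distinguished norm\<close>

definition plane_hausdorff :: "(real^2 \<Rightarrow> real) \<Rightarrow> (real^2) measure" where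
  "plane_hausdorff N = hausdorff_measure 2 (\<lambda>x y. N (x - y))"

lemma sets_plane_hausdorff[simp, measurable_cong]: "sets (plane_hausdorff N) = sets borel"
  and space_plane_hausdorff[simp]: "space (plane_hausdorff N) = UNIV"
  by (simp_all add: plane_hausdorff_def)

lemma ball_L2_norm_plane:
  fixes N :: "real^2 \<Rightarrow> real"
  shows "ball_L2_norm c N f = sqrt (c * (LINT v:{v. N v < 1}|plane_hausdorff N. \<bar>f v\<bar>\<^sup>2))"
  by (simp add: ball_L2_norm_def plane_hausdorff_def)

lemma linear_plane:
  fixes f :: "real^2 \<Rightarrow> real"
  assumes "linear f"
  shows "f v = f (axis 1 1) * v $ 1 + f (axis 2 1) * v $ 2"
proof -
  have "v = v $ 1 *\<^sub>R axis 1 1 + v $ 2 *\<^sub>R axis 2 1"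
    by (simp add: vec_eq_iff forall_2 axis_def)
  then have "f v = f (v $ 1 *\<^sub>R axis 1 1 + v $ 2 *\<^sub>R axis 2 1)"
    by simp
  then show ?thesis
    using assms by (simp add: linear_add linear_cmul)
qed

text \<open>These are the only properties of the tangent norms that the estimates below depend on; they
  hold uniformly in \<open>\<delta>\<close> and in the base point.\<close>

locale sandwiched =
  fixes N :: "real^2 \<Rightarrow> real"
  assumes ge_comp: "\<bar>v $ i\<bar> \<le> N v" and le_norm: "N v \<le> norm v"
    and diff_le: "N v \<le> N w + norm (v - w)"
begin

lemma open_ball: "open {v. N v < 1}"
proof -
  have "continuous_on UNIV N"
    unfolding continuous_on_iff dist_norm real_norm_def
  proof (intro ballI allI impI)
    fix x e assume "(0::real) < e"
    have "\<bar>N y - N x\<bar> \<le> norm (y - x)" for y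
      using diff_le[of x y] diff_le[of y x] by (simp add: norm_minus_commute abs_le_iff)
    then show "\<exists>d>0. \<forall>y\<in>UNIV. norm (y - x) < d \<longrightarrow> \<bar>N y - N x\<bar> < e"
      using \<open>0 < e\<close> by (meson le_less_trans)
  qed
  then have "open (N -` {..<1})"
    by (intro open_vimage) auto
  then show ?thesis by (simp add: vimage_def)
qed

lemma ball_sets[measurable]: "{v. N v < 1} \<in> sets borel"
  by (rule borel_open[OF open_ball])

lemma emeasure_plane: "A \<in> sets borel \<Longrightarrow> emeasure (plane_hausdorff N) A = hausdorff_outer 2 (\<lambda>x y. N (x - y)) A"
  unfolding plane_hausdorff_def
proof (rule emeasure_hausdorff_measure)
  \<comment> \<open>The Euclidean norm is at most the l1 norm, which is at most twice the maximum
    norm.\<close>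
  show "(1 / 2) * dist x y \<le> N (x - y)" for x y
    using norm_le_l1_cart[of "x - y"] ge_comp[of "x - y" 1] ge_comp[of "x - y" 2]
    by (simp add: dist_norm sum_2)
qed auto

lemma emeasure_ball_le: "emeasure (plane_hausdorff N) {v. N v < 1} \<le> ennreal (4 * pi)"
proof -
  have "{v. N v < 1} \<subseteq> {v. \<bar>v $ 1\<bar> < 1 \<and> \<bar>v $ 2\<bar> < 1}"
    using ge_comp le_less_trans by blast
  then have "hausdorff_outer 2 (\<lambda>x y. N (x - y)) {v. N v < 1} \<le>
      hausdorff_outer 2 (\<lambda>x y. N (x - y)) {v. \<bar>v $ 1\<bar> < 1 \<and> \<bar>v $ 2\<bar> < 1}"
    by (rule hausdorff_outer_mono)
  also have "\<dots> \<le> ennreal (4 * pi)"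
    by (rule hausdorff_outer_square_le) (rule le_norm)
  finally show ?thesis
    by (simp add: emeasure_plane ball_sets)
qed

lemma emeasure_ball_finite: "emeasure (plane_hausdorff N) {v. N v < 1} < \<infinity>"
  using emeasure_ball_le by (rule le_less_trans) simp

text \<open>In the unit ball both coordinates are at most 1 in absolute value, so a linear
  functional is bounded there, on a set of finite measure.\<close>

lemma integrable_linear_square:
  fixes f :: "real^2 \<Rightarrow> real"
  assumes f: "linear f"
  shows "integrable (plane_hausdorff N) (\<lambda>v. indicator {v. N v < 1} v *\<^sub>R \<bar>f v\<bar>\<^sup>2)"
proof -
  let ?C = "(\<bar>f (axis 1 1)\<bar> + \<bar>f (axis 2 1)\<bar>)\<^sup>2"
  have int: "integrable (plane_hausdorff N) (\<lambda>v. ?C * indicator {v. N v < 1} v)"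
    using emeasure_ball_finite by (intro integrable_mult_right integrable_real_indicator) auto
  have [measurable]: "f \<in> borel_measurable borel"
    using f by (intro borel_measurable_continuous_onI linear_continuous_on) (simp add: linear_conv_bounded_linear)
  have meas: "(\<lambda>v. indicator {v. N v < 1} v *\<^sub>R \<bar>f v\<bar>\<^sup>2) \<in> borel_measurable (plane_hausdorff N)"
    by measurable
  have "\<bar>f v\<bar>\<^sup>2 \<le> ?C" if "N v < 1" for v
  proof (rule power_mono)
    have "\<bar>v $ 1\<bar> \<le> 1" "\<bar>v $ 2\<bar> \<le> 1"
      using that ge_comp[of v] by (meson less_imp_le order_trans)+
    then have "\<bar>f (axis 1 1) * v $ 1\<bar> \<le> \<bar>f (axis 1 1)\<bar> * 1" "\<bar>f (axis 2 1) * v $ 2\<bar> \<le> \<bar>f (axis 2 1)\<bar> * 1"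
      unfolding abs_mult by (intro mult_left_mono; simp)+
    then show "\<bar>f v\<bar> \<le> \<bar>f (axis 1 1)\<bar> + \<bar>f (axis 2 1)\<bar>"
      unfolding linear_plane[OF f, of v] by simp
  qed simp
  then have "AE v in plane_hausdorff N.
      norm (indicator {v. N v < 1} v *\<^sub>R \<bar>f v\<bar>\<^sup>2) \<le> norm (?C * indicator {v. N v < 1} v)"
    by (intro AE_I2) (auto simp: indicator_def)
  with int meas show ?thesis
    by (rule Bochner_Integration.integrable_bound)
qed

text \<open>A small square T in the ball, of area 1/16 and thus of Hausdorff measure at least
  pi/256, carries |f|^2 \<ge> a^2 / 16. The bound makes the supremum in
  \<open>distinguished_norm\<close> finite and \<open>disc_integral\<close> positive.\<close>

lemma ball_integral_ge:
  fixes f :: "real^2 \<Rightarrow> real"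
  assumes f: "linear f"
  shows "pi / 4096 * (f (axis 1 1))\<^sup>2 \<le> (LINT v:{v. N v < 1}|plane_hausdorff N. \<bar>f v\<bar>\<^sup>2)"
proof -
  define a b where "a = f (axis 1 1)" and "b = f (axis 2 1)"
  have f_eq: "f v = a * v $ 1 + b * v $ 2" for v
    unfolding a_def b_def by (rule linear_plane[OF f])
  \<comment> \<open>The side is chosen so that the mixed term 2 a b v_1 v_2 in the square of f is
    nonnegative and may be dropped along with the b^2 term.\<close>
  define J where "J = (if 0 \<le> a * b then {0<..<1 / 4 :: real} else {-1 / 4<..<0})"
  define T where "T = {v :: real^2. v $ 1 \<in> {1 / 4<..<1 / 2} \<and> v $ 2 \<in> J}"
  have J[measurable]: "J \<in> sets borel" and J_meas: "emeasure lborel J = ennreal (1 / 4)"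
    and J_abs: "s \<in> J \<Longrightarrow> \<bar>s\<bar> < 1 / 4" and J_sgn: "s \<in> J \<Longrightarrow> 0 \<le> a * b * s" for s
    by (auto simp: J_def mult_nonpos_nonpos split: if_splits)
  have T[measurable]: "T \<in> sets borel"
    unfolding T_def by measurable
  have T_sub: "T \<subseteq> {v. N v < 1}"
  proof
    fix v assume "v \<in> T"
    then have "\<bar>v $ 1\<bar> + \<bar>v $ 2\<bar> < 1"
      using J_abs[of "v $ 2"] by (auto simp: T_def)
    then have "norm v < 1"
      using norm_le_l1_cart[of v] by (simp add: sum_2)
    then show "v \<in> {v. N v < 1}"
      using le_norm[of v] by simp
  qed
  have T_fin: "emeasure (plane_hausdorff N) T < \<infinity>"
    by (rule le_less_trans[OF emeasure_mono[OF T_sub] emeasure_ball_finite]) simp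
  have "ennreal (pi / 16) * emeasure lborel T \<le> emeasure (plane_hausdorff N) T"
    unfolding emeasure_plane[OF T] using T
    by (intro hausdorff_outer_ge_lborel) (use ge_comp[of "_ - _"] in simp)
  also have "emeasure lborel T = ennreal (1 / 4) * ennreal (1 / 4)"
    unfolding T_def by (subst emeasure_vec2_times) (auto simp: J_meas)
  also have "ennreal (pi / 16) * (ennreal (1 / 4) * ennreal (1 / 4)) = ennreal (pi / 256)"
    by (simp flip: ennreal_mult)
  finally have T_meas: "pi / 256 \<le> measure (plane_hausdorff N) T"
    using T_fin by (simp add: emeasure_eq_ennreal_measure less_top ennreal_le_iff)
  have point: "a\<^sup>2 / 16 * indicator T v \<le> indicator {v. N v < 1} v *\<^sub>R \<bar>f v\<bar>\<^sup>2" for v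
  proof (cases "v \<in> T")
    case True
    have v1: "1 / 4 \<le> v $ 1" and v2: "v $ 2 \<in> J"
      using True by (auto simp: T_def)
    have "a\<^sup>2 * (1 / 4)\<^sup>2 \<le> a\<^sup>2 * (v $ 1)\<^sup>2"
      using v1 by (intro mult_left_mono power_mono) auto
    also have "\<dots> \<le> a\<^sup>2 * (v $ 1)\<^sup>2 + 2 * ((a * b * v $ 2) * v $ 1) + b\<^sup>2 * (v $ 2)\<^sup>2"
      using J_sgn[OF v2] v1 by (simp add: add_nonneg_nonneg)
    also have "\<dots> = \<bar>f v\<bar>\<^sup>2"
      unfolding f_eq by (simp add: power2_eq_square algebra_simps)
    finally show ?thesis
      using True T_sub by (auto simp: power2_eq_square indicator_def)
  qed auto
  have "pi / 4096 * a\<^sup>2 = a\<^sup>2 / 16 * (pi / 256)"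
    by simp
  also have "\<dots> \<le> a\<^sup>2 / 16 * measure (plane_hausdorff N) T"
    by (intro mult_left_mono T_meas) auto
  also have "\<dots> = (LINT v|plane_hausdorff N. a\<^sup>2 / 16 * indicator T v)"
    by simp
  also have "\<dots> \<le> (LINT v|plane_hausdorff N. indicator {v. N v < 1} v *\<^sub>R \<bar>f v\<bar>\<^sup>2)"
    using T_fin point by (intro integral_mono integrable_linear_square f integrable_mult_right
        integrable_real_indicator) auto
  finally show ?thesis
    unfolding a_def set_lebesgue_integral_def .
qed

lemma ball_integral_le:
  "(LINT v:{v. N v < 1}|plane_hausdorff N. \<bar>l * v $ 1\<bar>\<^sup>2) \<le> l\<^sup>2 * (4 * pi)"
proof -
  have lin: "linear (\<lambda>v::real^2. l * v $ 1)"
    by (rule linearI) (auto simp: algebra_simps)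
  have "indicator {v. N v < 1} v *\<^sub>R \<bar>l * v $ 1\<bar>\<^sup>2 \<le> l\<^sup>2 * indicator {v. N v < 1} v" for v
  proof (cases "N v < 1")
    case True
    then have "\<bar>v $ 1\<bar> \<le> 1"
      using ge_comp[of v 1] by simp
    then have "(v $ 1)\<^sup>2 \<le> 1"
      by (simp add: abs_square_le_1)
    then have "l\<^sup>2 * (v $ 1)\<^sup>2 \<le> l\<^sup>2 * 1"
      by (intro mult_left_mono) auto
    with True show ?thesis by (simp add: power_mult_distrib)
  qed simp
  then have "(LINT v:{v. N v < 1}|plane_hausdorff N. \<bar>l * v $ 1\<bar>\<^sup>2) \<le>
      (LINT v|plane_hausdorff N. l\<^sup>2 * indicator {v. N v < 1} v)"
    unfolding set_lebesgue_integral_def using emeasure_ball_finite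
    by (intro integral_mono integrable_linear_square lin integrable_mult_right integrable_real_indicator) auto
  also have "\<dots> = l\<^sup>2 * measure (plane_hausdorff N) {v. N v < 1}"
    by simp
  also have "\<dots> \<le> l\<^sup>2 * (4 * pi)"
    using emeasure_ball_le by (intro mult_left_mono) (auto simp: measure_def enn2real_leI)
  finally show ?thesis .
qed

end

lemma sandwiched_norm: "sandwiched norm"
  by standard (auto simp: component_le_norm_cart norm_triangle_sub)

lemma sandwiched_tangent_norm: "0 \<le> \<delta> \<Longrightarrow> \<delta> \<le> 1 \<Longrightarrow> sandwiched (tangent_norm \<delta> z)"
  by standard (rule tangent_norm_ge tangent_norm_le tangent_norm_diff; assumption)+

section \<open>The normalising constant in the plane\<close>

text \<open>The second moment of one coordinate over the Euclidean unit disc; its reciprocal turns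
  out to be the normalising constant. Only its positivity enters the estimates.\<close>

definition disc_integral :: real where
  "disc_integral = (LINT v:{v. norm v < 1}|plane_hausdorff norm. \<bar>v $ 1\<bar>\<^sup>2)"

lemma linear_fst: "linear (\<lambda>v::real^2. l * v $ 1)"
  by (rule linearI) (auto simp: algebra_simps)

lemma disc_integral_pos: "0 < disc_integral"
proof -
  interpret sandwiched norm by (rule sandwiched_norm)
  have "pi / 4096 * (1 * axis 1 1 $ 1)\<^sup>2 \<le> disc_integral"
    using ball_integral_ge[OF linear_fst[of 1]] by (simp add: disc_integral_def)
  then have "pi / 4096 \<le> disc_integral"
    by (simp add: axis_def)
  then show ?thesis
    using pi_gt_zero by linarith
qed

text \<open>For a functional \<open>f\<close>, an orthonormal basis of the inner product whose second vector lies in the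
  kernel of \<open>f\<close> maps the Euclidean plane isometrically so that \<open>f\<close> becomes a multiple of \<open>x\<^sub>1\<close>.\<close>

lemma inner_product_norm_adapted_isometry:
  fixes N f :: "real^2 \<Rightarrow> real"
  assumes N: "inner_product_norm N" and f: "linear f"
  obtains S :: "real^2 \<Rightarrow> real^2" and \<beta> where
    "linear S" "\<And>w. N (S w) = norm w" "\<And>w. f (S w) = \<beta> * w $ 1"
proof -
  obtain B where bil: "bilinear B" and sym: "\<And>v w. B v w = B w v"
    and pos: "\<And>v. v \<noteq> 0 \<Longrightarrow> 0 < B v v" and N_eq: "\<And>v. N v = sqrt (B v v)"
    using N unfolding inner_product_norm_def by blast
  note B_simps = bilinear_ladd[OF bil] bilinear_radd[OF bil] bilinear_lmul[OF bil] bilinear_rmul[OF bil]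
    bilinear_lsub[OF bil] bilinear_rsub[OF bil]
  define nrm where "nrm v = v /\<^sub>R sqrt (B v v)" for v
  have nrm: "B (nrm v) (nrm v) = 1" if "v \<noteq> 0" for v
  proof -
    define s where "s = sqrt (B v v)"
    have s: "0 < s" "B v v = s * s"
      using pos[OF that] by (simp_all add: s_def)
    have "B (nrm v) (nrm v) = inverse s * (inverse s * B v v)"
      by (simp add: nrm_def s_def B_simps)
    then show ?thesis
      using s(1) by (simp add: s(2) field_simps)
  qed
  \<comment> \<open>A nonzero vector of the kernel: the coefficient vector of f turned by a right
    angle, or any vector if f = 0.\<close>
  define k :: "real^2" where "k = (if f (axis 1 1) = 0 \<and> f (axis 2 1) = 0 then axis 1 1
    else f (axis 2 1) *\<^sub>R axis 1 1 - f (axis 1 1) *\<^sub>R axis 2 1)"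
  have k0: "k \<noteq> 0"
    by (auto simp: k_def vec_eq_iff forall_2 axis_def)
  have fk: "f k = 0"
    by (simp add: k_def linear_diff[OF f] linear_cmul[OF f])
  define b2 where "b2 = nrm k"
  have b2: "B b2 b2 = 1" "f b2 = 0"
    using nrm[OF k0] fk by (simp_all add: b2_def nrm_def linear_cmul[OF f])
  \<comment> \<open>The Gram-Schmidt step needs a vector that is not a multiple of b2; otherwise the
    plane would be a line.\<close>
  have "\<exists>p. p - B p b2 *\<^sub>R b2 \<noteq> 0"
  proof (rule ccontr)
    assume "\<nexists>p. p - B p b2 *\<^sub>R b2 \<noteq> 0"
    then have *: "p = B p b2 *\<^sub>R b2" for p by simp
    define s t where "s = B (axis 1 1) b2" and "t = B (axis 2 1) b2"
    have 1: "axis 1 1 = s *\<^sub>R b2" and 2: "axis 2 1 = t *\<^sub>R b2"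
      unfolding s_def t_def by (rule *)+
    have "s * b2 $ 1 = 1" "s * b2 $ 2 = 0" "t * b2 $ 2 = 1"
      using arg_cong[OF 1, of "\<lambda>v. v $ 1"] arg_cong[OF 1, of "\<lambda>v. v $ 2"] arg_cong[OF 2, of "\<lambda>v. v $ 2"]
      by (simp_all add: axis_def)
    then show False by auto
  qed
  then obtain p where p: "p - B p b2 *\<^sub>R b2 \<noteq> 0" by blast
  define b1 where "b1 = nrm (p - B p b2 *\<^sub>R b2)"
  have b1: "B b1 b1 = 1"
    unfolding b1_def by (rule nrm[OF p])
  have b12: "B b1 b2 = 0"
    by (simp add: b1_def nrm_def B_simps b2)
  define S where "S w = w $ 1 *\<^sub>R b1 + w $ 2 *\<^sub>R b2" for w :: "real^2"
  have "linear S"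
    by (rule linearI) (auto simp: S_def algebra_simps)
  moreover have "N (S w) = norm w" for w
    by (simp add: N_eq S_def B_simps b1 b2 b12 sym[of b2 b1] norm_eq_sqrt_inner inner_vec_def sum_2)
  moreover have "f (S w) = f b1 * w $ 1" for w
    by (simp add: S_def linear_add[OF f] linear_cmul[OF f] b2)
  ultimately show ?thesis by (rule that)
qed

text \<open>The adapted isometry S carries Euclidean Hausdorff measure to that of N and turns f into
  \<beta> x_1, whose dual norm is |\<beta>|. The ratio of the integral to the squared dual norm is
  thus the same for every inner product norm.\<close>

lemma inner_product_norm_ball:
  fixes N f :: "real^2 \<Rightarrow> real"
  assumes N: "inner_product_norm N" and f: "linear f"
  shows "(LINT v:{v. N v < 1}|plane_hausdorff N. \<bar>f v\<bar>\<^sup>2) = (dual_norm N f)\<^sup>2 * disc_integral"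
    and "0 \<le> dual_norm N f"
proof -
  obtain S :: "real^2 \<Rightarrow> real^2" and \<beta> where S: "linear S" and NS: "\<And>w. N (S w) = norm w"
    and fS: "\<And>w. f (S w) = \<beta> * w $ 1"
    using inner_product_norm_adapted_isometry[OF N f] by blast
  have "N 0 = 0"
    using NS[of 0] by (simp add: linear_0[OF S])
  have "inj S"
    unfolding linear_injective_0[OF S] using NS \<open>N 0 = 0\<close> by (metis norm_eq_zero)
  then obtain S' where S': "linear S'" "\<And>x. S' (S x) = x" "\<And>x. S (S' x) = x"
    using linear_injective_isomorphism[OF S] by blast
  have "bij S"
    using S' by (intro bijI') metis+
  have N_S': "N v = norm (S' v)" for v
    using NS[of "S' v"] by (simp add: S')
  have cont: "continuous_on UNIV S" "continuous_on UNIV S'" "continuous_on UNIV f"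
    using S S'(1) f by (simp_all add: linear_continuous_on linear_conv_bounded_linear)
  then have [measurable]: "S \<in> borel_measurable borel" "S' \<in> borel_measurable borel" "f \<in> borel_measurable borel"
    by (simp_all add: borel_measurable_continuous_onI)
  have ball[measurable]: "{v. N v < 1} \<in> sets borel"
    unfolding N_S' by measurable
  \<comment> \<open>An arbitrary inner product norm need not dominate the maximum norm, so the lower
    comparison with Euclidean distance is obtained from the boundedness of S.\<close>
  obtain K where K: "0 < K" "\<And>w. norm (S w) \<le> norm w * K"
    using bounded_linear.pos_bounded[of S] S by (auto simp: linear_conv_bounded_linear)
  have em: "emeasure (plane_hausdorff N) A = hausdorff_outer 2 (\<lambda>x y. N (x - y)) A" if "A \<in> sets borel" for A
    unfolding plane_hausdorff_def
  proof (rule emeasure_hausdorff_measure)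
    show "inverse K * dist x y \<le> N (x - y)" for x y
      using K(2)[of "S' (x - y)"] K(1) by (simp add: N_S' S' dist_norm field_simps)
  qed (use K that in auto)
  interpret norm: sandwiched norm by (rule sandwiched_norm)
  have distr: "plane_hausdorff N = distr (plane_hausdorff norm) borel S"
  proof (rule measure_eqI)
    fix A assume "A \<in> sets (plane_hausdorff N)"
    then have A[measurable]: "A \<in> sets borel" by simp
    have "S -` A \<in> sets borel"
      using measurable_sets[of S borel borel A] by simp
    moreover have "S ` (S -` A) = A"
      using \<open>bij S\<close> by (simp add: bij_is_surj surj_image_vimage_eq)
    moreover have "hausdorff_outer 2 (\<lambda>x y. N (x - y)) (S ` (S -` A)) =
        hausdorff_outer 2 (\<lambda>x y. norm (x - y)) (S -` A)"
      using \<open>bij S\<close> by (rule hausdorff_outer_isometry) (simp add: NS flip: linear_diff[OF S])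
    ultimately show "emeasure (plane_hausdorff N) A = emeasure (distr (plane_hausdorff norm) borel S) A"
      by (simp add: em A emeasure_distr norm.emeasure_plane)
  qed simp
  have "(LINT v:{v. N v < 1}|plane_hausdorff N. \<bar>f v\<bar>\<^sup>2) =
      (LINT w|plane_hausdorff norm. indicator {v. N v < 1} (S w) *\<^sub>R \<bar>f (S w)\<bar>\<^sup>2)"
    unfolding set_lebesgue_integral_def distr by (rule integral_distr) measurable
  also have "\<dots> = (LINT w|plane_hausdorff norm. \<beta>\<^sup>2 * (indicator {v. norm v < 1} w *\<^sub>R \<bar>w $ 1\<bar>\<^sup>2))"
    by (intro Bochner_Integration.integral_cong) (auto simp: fS NS power_mult_distrib indicator_def)
  also have "\<dots> = \<beta>\<^sup>2 * disc_integral"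
    by (simp add: disc_integral_def set_lebesgue_integral_def)
  finally have int: "(LINT v:{v. N v < 1}|plane_hausdorff N. \<bar>f v\<bar>\<^sup>2) = \<beta>\<^sup>2 * disc_integral" .
  have dual: "dual_norm N f = \<bar>\<beta>\<bar>"
    unfolding dual_norm_def
  proof (rule cSup_eq_maximum)
    show "\<bar>\<beta>\<bar> \<in> (\<lambda>v. \<bar>f v\<bar>) ` {v. N v \<le> 1}"
      by (rule image_eqI[of _ _ "S (axis 1 1)"]) (simp_all add: fS NS axis_nth)
    fix t assume "t \<in> (\<lambda>v. \<bar>f v\<bar>) ` {v. N v \<le> 1}"
    then obtain v where v: "N v \<le> 1" "t = \<bar>f v\<bar>" by blast
    have "\<bar>S' v $ 1\<bar> \<le> 1"
      using v(1) component_le_norm_cart[of "S' v" 1] by (simp add: N_S')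
    then have "\<bar>\<beta>\<bar> * \<bar>S' v $ 1\<bar> \<le> \<bar>\<beta>\<bar> * 1"
      by (intro mult_left_mono) auto
    then show "t \<le> \<bar>\<beta>\<bar>"
      using fS[of "S' v"] v(2) by (simp add: S' abs_mult)
  qed
  show "(LINT v:{v. N v < 1}|plane_hausdorff N. \<bar>f v\<bar>\<^sup>2) = (dual_norm N f)\<^sup>2 * disc_integral"
    unfolding int dual by simp
  show "0 \<le> dual_norm N f"
    by (simp add: dual)
qed

lemma inner_product_norm_norm: "inner_product_norm (norm :: real^2 \<Rightarrow> real)"
  unfolding inner_product_norm_def
  by (intro exI[of _ inner]) (auto simp: bilinear_conv_bounded_bilinear bounded_bilinear_inner
      inner_commute norm_eq_sqrt_inner)

text \<open>The definite description needs existence, which is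
  \<open>inner_product_norm_ball\<close>, and uniqueness, for which the Euclidean norm with the
  first coordinate is a sufficient test.\<close>

lemma cheeger_const_plane: "cheeger_const TYPE(real^2) = 1 / disc_integral"
  unfolding cheeger_const_def
proof (rule the_equality)
  have "ball_L2_norm (1 / disc_integral) N f = dual_norm N f"
    if "inner_product_norm N" "linear f" for N f :: "real^2 \<Rightarrow> real"
    using disc_integral_pos inner_product_norm_ball[OF that] by (simp add: ball_L2_norm_plane)
  then show "0 < 1 / disc_integral \<and> (\<forall>N :: real^2 \<Rightarrow> real. inner_product_norm N \<longrightarrow>
      (\<forall>f. linear f \<longrightarrow> ball_L2_norm (1 / disc_integral) N f = dual_norm N f))"
    using disc_integral_pos by simp
next
  fix c assume c: "0 < c \<and> (\<forall>N :: real^2 \<Rightarrow> real. inner_product_norm N \<longrightarrow>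
      (\<forall>f. linear f \<longrightarrow> ball_L2_norm c N f = dual_norm N f))"
  let ?f = "\<lambda>v::real^2. 1 * v $ 1"
  have "disc_integral = (dual_norm norm ?f)\<^sup>2 * disc_integral"
    using inner_product_norm_ball(1)[OF inner_product_norm_norm linear_fst[of 1]]
    by (simp add: disc_integral_def)
  then have "(dual_norm norm ?f)\<^sup>2 = 1"
    using disc_integral_pos by simp
  moreover have "sqrt (c * disc_integral) = dual_norm norm ?f"
    using c inner_product_norm_norm linear_fst[of 1]
    by (simp add: ball_L2_norm_plane disc_integral_def)
  ultimately have "c * disc_integral = 1"
    using c disc_integral_pos by (metis less_imp_le mult_nonneg_nonneg real_sqrt_pow2)
  then show "c = 1 / disc_integral"
    using disc_integral_pos by (simp add: field_simps)
qed

section \<open>The uniform lower bound and the inequality on E\<close>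

text \<open>The functional l x_1 has second moment at most 4 pi l^2 over the unit ball, so it lies
  in the dual unit ball when l^2 = \<open>disc_integral\<close> / (4 pi), and it takes the value l
  at the first basis vector.\<close>

lemma (in sandwiched) distinguished_norm_ge:
  "disc_integral / (4 * pi) \<le> (distinguished_norm N (axis 1 1))\<^sup>2"
proof -
  define c where "c = cheeger_const TYPE(real^2)"
  have c: "c = 1 / disc_integral" "0 < c"
    using disc_integral_pos by (simp_all add: c_def cheeger_const_plane)
  define D where "D = {f. linear f \<and> distinguished_dual_norm N f \<le> 1}"
  have D: "f \<in> D \<longleftrightarrow> linear f \<and> c * (LINT v:{v. N v < 1}|plane_hausdorff N. \<bar>f v\<bar>\<^sup>2) \<le> 1" for f
    by (simp add: D_def distinguished_dual_norm_def ball_L2_norm_plane c_def)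
  \<comment> \<open>Without an upper bound the real supremum would be unspecified and a single
    functional would say nothing about it.\<close>
  have bdd: "bdd_above ((\<lambda>f. f (axis 1 1)) ` D)"
  proof (rule bdd_aboveI2)
    fix f assume "f \<in> D"
    then have f: "linear f" "c * (LINT v:{v. N v < 1}|plane_hausdorff N. \<bar>f v\<bar>\<^sup>2) \<le> 1"
      by (simp_all add: D)
    have "c * (pi / 4096 * (f (axis 1 1))\<^sup>2) \<le> 1"
      using ball_integral_ge[OF f(1)] f(2) c(2) by (meson less_imp_le mult_left_mono order_trans)
    then have "(f (axis 1 1))\<^sup>2 \<le> 4096 / (c * pi)"
      using c(2) by (simp add: field_simps)
    then show "f (axis 1 1) \<le> sqrt (4096 / (c * pi))"
      by (rule real_le_rsqrt)
  qed
  define l where "l = sqrt (disc_integral / (4 * pi))"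
  have l: "l\<^sup>2 = disc_integral / (4 * pi)" "0 \<le> l"
    using disc_integral_pos by (simp_all add: l_def)
  have "c * (LINT v:{v. N v < 1}|plane_hausdorff N. \<bar>l * v $ 1\<bar>\<^sup>2) \<le> c * (l\<^sup>2 * (4 * pi))"
    using c(2) by (intro mult_left_mono ball_integral_le) auto
  also have "\<dots> = 1"
    using disc_integral_pos by (simp add: l c)
  finally have "(\<lambda>v. l * v $ 1) \<in> D"
    by (simp add: D linear_fst)
  from cSUP_upper[OF this bdd] have "l * axis 1 1 $ 1 \<le> (SUP f\<in>D. f (axis 1 1))"
    by simp
  then have "l \<le> distinguished_norm N (axis 1 1)"
    by (simp add: distinguished_norm_def D_def axis_nth)
  then have "l\<^sup>2 \<le> (distinguished_norm N (axis 1 1))\<^sup>2"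
    using l(2) by (rule power_mono)
  then show ?thesis by (simp add: l)
qed

theorem proposition3p2:
  shows "\<exists>\<delta>\<^sub>E::real. 0 < \<delta>\<^sub>E \<and> \<delta>\<^sub>E < 1 \<and>
    (\<forall>\<delta>::real. \<delta>\<^sub>E < \<delta> \<and> \<delta> < 1 \<longrightarrow>
      (\<exists>u :: real^2 \<Rightarrow> real. (\<exists>L. L-lipschitz_on UNIV u) \<and>
        (\<exists>A\<in>sets lebesgue. 0 < emeasure lebesgue A \<and>
          (\<forall>z\<in>A. energy_density \<delta> u z <
             ennreal ((distinguished_norm (tangent_norm \<delta> z) (cheeger_derivative u z))\<^sup>2)))))"
proof -
  define q where "q = disc_integral / (4 * pi)"
  have "0 < q"
    using disc_integral_pos by (simp add: q_def)
  define u where "u z = axis 1 1 \<bullet> z" for z :: "real^2"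
  have "1-lipschitz_on UNIV u"
    using component_le_norm_cart[of "_ - _ :: real^2" 1]
    by (intro lipschitz_onI) (auto simp: u_def dist_norm inner_axis' simp flip: vector_minus_component)
  have deriv: "cheeger_derivative u z = axis 1 1" for z
  proof -
    have "u (z + t *\<^sub>R axis i 1) = u z + t * (if i = 1 then 1 else 0)" for t i
      by (simp add: u_def inner_add_right inner_axis_axis)
    then have "((\<lambda>t. u (z + t *\<^sub>R axis i 1)) has_real_derivative (if i = 1 then 1 else 0)) (at 0)" for i
      by (auto intro!: derivative_eq_intros)
    then show ?thesis
      by (simp add: cheeger_derivative_def DERIV_imp_deriv axis_def vec_eq_iff)
  qed
  \<comment> \<open>Beyond 1 - q the density 1 - \<delta> on E drops below q; the 1/2 keeps the
    threshold positive in case q \<ge> 1.\<close>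
  have "\<exists>A\<in>sets lebesgue. 0 < emeasure lebesgue A \<and>
      (\<forall>z\<in>A. energy_density \<delta> u z <
         ennreal ((distinguished_norm (tangent_norm \<delta> z) (cheeger_derivative u z))\<^sup>2))"
    if \<delta>: "max (1 / 2) (1 - q) < \<delta>" "\<delta> < 1" for \<delta>
  proof -
    have "has_weak_gradient u (\<lambda>_. axis 1 1)"
      using has_weak_gradient_linear[of "axis 1 1"] by (simp add: u_def[abs_def])
    then have "AE z in lebesgue. energy_density \<delta> u z = ennreal ((1 - \<delta> * indicator set_E z) * (norm (axis 1 1 :: real^2))\<^sup>2)"
      by (rule energy_density_eq)
    then have "AE z in lebesgue. energy_density \<delta> u z = ennreal (1 - \<delta> * indicator set_E z)"
      by simp
    \<comment> \<open>The strict inequality is claimed at every point of the set, whereas the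
      density is known almost everywhere; the exceptional null set is cut out of E.\<close>
    then obtain Z where Z: "{z \<in> space lebesgue. energy_density \<delta> u z \<noteq> ennreal (1 - \<delta> * indicator set_E z)} \<subseteq> Z"
      "emeasure lebesgue Z = 0" "Z \<in> sets lebesgue"
      by (rule AE_E)
    then have null: "Z \<in> null_sets lebesgue"
      by (simp only: null_setsI)
    have E: "set_E \<in> sets lebesgue"
      using closed_set_E by (auto intro: borel_closed)
    show ?thesis
    proof (intro bexI[of _ "set_E - Z"] conjI ballI)
      have "emeasure lebesgue (set_E - Z) = emeasure lebesgue set_E"
        using null E by (rule emeasure_Diff_null_set)
      then show "0 < emeasure lebesgue (set_E - Z)"
        using emeasure_set_E_pos closed_set_E by (simp add: borel_closed)
      show "set_E - Z \<in> sets lebesgue"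
        using Z(3) E by (rule sets.Diff[rotated])
      fix z assume z: "z \<in> set_E - Z"
      interpret sandwiched "tangent_norm \<delta> z"
        using \<delta> by (intro sandwiched_tangent_norm) auto
      have "energy_density \<delta> u z = ennreal (1 - \<delta> * indicator set_E z)"
      proof (rule ccontr)
        assume "energy_density \<delta> u z \<noteq> ennreal (1 - \<delta> * indicator set_E z)"
        then have "z \<in> Z" by (intro subsetD[OF Z(1)]) simp
        with z show False by simp
      qed
      also have "\<dots> = ennreal (1 - \<delta>)"
        using z by simp
      also have "\<dots> < ennreal ((distinguished_norm (tangent_norm \<delta> z) (axis 1 1))\<^sup>2)"
        using distinguished_norm_ge \<delta> by (intro ennreal_lessI) (auto simp: q_def)
      finally show "energy_density \<delta> u z <
          ennreal ((distinguished_norm (tangent_norm \<delta> z) (cheeger_derivative u z))\<^sup>2)"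
        by (simp add: deriv)
    qed
  qed
  with \<open>1-lipschitz_on UNIV u\<close> \<open>0 < q\<close> show ?thesis
    by (intro exI[of _ "max (1 / 2) (1 - q)"]) auto
qed

end
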